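(* Let $p$ be a Nehari function and let $\phi:\mathbb{D}\to\mathbb{C}^n$ ($n\ge 1$) be holomorphic with $\phi'\neq 0$ on $\mathbb{D}$ and $$|\mathcal{S}\phi(z)|+\frac34\,|\phi'(z)|^2\,|K(\phi(z))|\le 2p(|z|),\qquad z\in\mathbb{D}.$$ Then $\phi$ has an extension to a map $\overline{\mathbb{D}}\to\mathbb{C}^n\cup\{\infty\}$ that is uniformly continuous in the spherical metric.
   Context: $\mathbb{D}$ is the open unit disk in $\mathbb{C}$. For a holomorphic curve $\phi=(f_1,\dots,f_n):\mathbb{D}\to\mathbb{C}^n$ with $\phi'=(f_1',\dots,f_n')\ne 0$, put $\sigma=\frac12\log(|f_1'|^2+\cdots+|f_n'|^2)$, so $|\phi'|=e^{\sigma}$ is the Euclidean norm of $\phi'$. The Schwarzian derivative of $\phi$ is $\mathcal{S}\phi=2(\sigma_{zz}-\sigma_z^2)$, where $\sigma_z=\frac12(\sigma_x-i\sigma_y)$. $K(\phi(z))=-e^{-2\sigma(z)}\Delta\sigma(z)\le 0$ denotes the Gaussian curvature at $\phi(z)$ of the surface $\Sigma=\phi(\mathbb{D})\subset\mathbb{C}^n=\mathbb{R}^{2n}$ (with metric induced from the Euclidean metric). A Nehari function is a positive, even, continuous function $p:(-1,1)\to\mathbb{R}$ such that (a) $(1-x^2)^2p(x)$ is non-increasing for $x\in[0,1)$, and (b) the differential equation $u''+pu=0$ has no nontrivial solution with more than one zero in $(-1,1)$. The spherical metric is the metric on $\mathbb{C}^n\cup\{\infty\}=\mathbb{R}^{2n}\cup\{\infty\}$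 obtained by identification with the sphere $S^{2n}$ via stereographic projection. *)

theory Defs
  imports "HOL-Complex_Analysis.Complex_Analysis"
begin

definition partial_x :: "(complex \<Rightarrow> 'a::real_normed_vector) \<Rightarrow> complex \<Rightarrow> 'a" where
  "partial_x f z = vector_derivative (\<lambda>t::real. f (z + complex_of_real t)) (at 0)"

definition partial_y :: "(complex \<Rightarrow> 'a::real_normed_vector) \<Rightarrow> complex \<Rightarrow> 'a" where
  "partial_y f z = vector_derivative (\<lambda>t::real. f (z + \<i> * complex_of_real t)) (at 0)"

definition wirtinger :: "(complex \<Rightarrow> complex) \<Rightarrow> complex \<Rightarrow> complex" where
  "wirtinger f z = (partial_x f z - \<i> * partial_y f z) / 2"

definition laplacian :: "(complex \<Rightarrow> real) \<Rightarrow> complex \<Rightarrow> real" where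
  "laplacian f z = partial_x (partial_x f) z + partial_y (partial_y f) z"

definition curve_holomorphic_on :: "(complex \<Rightarrow> complex ^ 'n) \<Rightarrow> complex set \<Rightarrow> bool" where
  "curve_holomorphic_on \<phi> S \<longleftrightarrow> (\<forall>i. (\<lambda>z. \<phi> z $ i) holomorphic_on S)"

definition curve_deriv :: "(complex \<Rightarrow> complex ^ 'n) \<Rightarrow> complex \<Rightarrow> complex ^ 'n" where
  "curve_deriv \<phi> z = (\<chi> i. deriv (\<lambda>w. \<phi> w $ i) z)"

definition log_speed :: "(complex \<Rightarrow> complex ^ 'n) \<Rightarrow> complex \<Rightarrow> real" where
  "log_speed \<phi> z = ln (\<Sum>i\<in>UNIV. (cmod (deriv (\<lambda>w. \<phi> w $ i) z))\<^sup>2) / 2"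

lemma exp_log_speed:
  assumes "curve_deriv \<phi> z \<noteq> 0"
  shows "exp (log_speed \<phi> z) = norm (curve_deriv \<phi> z)"
proof -
  define S where "S = (\<Sum>i\<in>UNIV. (cmod (deriv (\<lambda>w. \<phi> w $ i) z))\<^sup>2)"
  have n: "norm (curve_deriv \<phi> z) = sqrt S"
    by (simp add: norm_vec_def L2_set_def curve_deriv_def S_def)
  with assms have "S > 0"
    by (simp flip: zero_less_norm_iff)
  then have "exp (ln S / 2) = sqrt S"
    by (simp flip: ln_sqrt)
  then show ?thesis
    by (simp add: n log_speed_def S_def)
qed

definition curve_schwarzian :: "(complex \<Rightarrow> complex ^ 'n) \<Rightarrow> complex \<Rightarrow> complex" where
  "curve_schwarzian \<phi> z =
    (let \<sigma> = (\<lambda>w. complex_of_real (log_speed \<phi> w))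
     in 2 * (wirtinger (wirtinger \<sigma>) z - (wirtinger \<sigma> z)\<^sup>2))"

text \<open>The Gaussian curvature of the image surface at the point \<open>\<phi> z\<close>, computed in the
  parametrization \<open>\<phi>\<close>, which is conformal, so that the induced metric is
  \<open>exp (2 * log_speed \<phi> z) * \<bar>dz\<bar>\<^sup>2\<close>.\<close>

definition gauss_curvature :: "(complex \<Rightarrow> complex ^ 'n) \<Rightarrow> complex \<Rightarrow> real" where
  "gauss_curvature \<phi> z = - exp (- 2 * log_speed \<phi> z) * laplacian (log_speed \<phi>) z"

definition solves_ode :: "(real \<Rightarrow> real) \<Rightarrow> (real \<Rightarrow> real) \<Rightarrow> bool" where
  "solves_ode p u \<longleftrightarrow>
    (\<exists>u' u''. \<forall>x\<in>{-1<..<1}.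
       (u has_real_derivative u' x) (at x) \<and>
       (u' has_real_derivative u'' x) (at x) \<and>
       u'' x + p x * u x = 0)"

text \<open>Only the values of \<open>p\<close> and \<open>u\<close> on the open interval are relevant; in particular
  \<open>u\<close> is nontrivial if it does not vanish identically there.\<close>

definition nehari_function :: "(real \<Rightarrow> real) \<Rightarrow> bool" where
  "nehari_function p \<longleftrightarrow>
    (\<forall>x\<in>{-1<..<1}. p x > 0) \<and>
    (\<forall>x\<in>{-1<..<1}. p (- x) = p x) \<and>
    continuous_on {-1<..<1} p \<and>
    antimono_on {0..<1} (\<lambda>x. (1 - x\<^sup>2)\<^sup>2 * p x) \<and>
    (\<forall>u. solves_ode p u \<and> (\<exists>x\<in>{-1<..<1}. u x \<noteq> 0) \<longrightarrow>
       (\<forall>x\<in>{-1<..<1}. \<forall>y\<in>{-1<..<1}. u x = 0 \<and> u y = 0 \<longrightarrow> x = y))"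

datatype 'a one_point = Finite_Point 'a | Infinity_Point

text \<open>Stereographic projection onto the unit sphere of \<open>'a \<times> real\<close> from the pole \<open>(0, 1)\<close>,
  which corresponds to the point at infinity.\<close>

fun to_sphere :: "'a::real_inner one_point \<Rightarrow> 'a \<times> real" where
  "to_sphere (Finite_Point x) =
     ((2 / ((norm x)\<^sup>2 + 1)) *\<^sub>R x, ((norm x)\<^sup>2 - 1) / ((norm x)\<^sup>2 + 1))"
| "to_sphere Infinity_Point = (0, 1)"

lemma inner_to_sphere_self: "to_sphere x \<bullet> to_sphere x = 1"
proof (cases x)
  case (Finite_Point v)
  define s where "s = (norm v)\<^sup>2"
  have "s \<ge> 0"
    by (simp add: s_def)
  then have pos: "s + 1 \<noteq> 0"
    by linarith
  have vv: "v \<bullet> v = s"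
    by (simp add: s_def power2_norm_eq_inner)
  have "to_sphere x \<bullet> to_sphere x = (2 / (s + 1))\<^sup>2 * s + ((s - 1) / (s + 1))\<^sup>2"
    unfolding Finite_Point to_sphere.simps inner_Pair s_def[symmetric]
    by (simp add: vv power2_eq_square)
  also have "\<dots> = (4 * s + (s - 1)\<^sup>2) / (s + 1)\<^sup>2"
    by (simp add: power_divide add_divide_distrib)
  also have "4 * s + (s - 1)\<^sup>2 = (s + 1)\<^sup>2"
    by (simp add: power2_eq_square algebra_simps)
  finally show ?thesis
    using pos by simp
qed (simp add: inner_Pair)

lemma norm_to_sphere: "norm (to_sphere x) = 1"
  by (simp add: norm_eq_sqrt_inner inner_to_sphere_self)

lemma inj_to_sphere: "inj to_sphere"
proof (rule injI)
  fix x y :: "'a one_point"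
  assume eq: "to_sphere x = to_sphere y"
  have pos: "(norm v)\<^sup>2 + 1 > 0" for v :: 'a
    by (simp add: add_nonneg_pos)
  have ht: "snd (to_sphere (Finite_Point v)) = 1 - 2 / ((norm v)\<^sup>2 + 1)" for v :: 'a
    using pos[of v] by (simp add: field_simps)
  have ne: "snd (to_sphere (Finite_Point v)) \<noteq> 1" for v :: 'a
    using pos[of v] unfolding ht by simp
  show "x = y"
  proof (cases x; cases y)
    fix v w
    assume xy: "x = Finite_Point v" "y = Finite_Point w"
    have "2 / ((norm v)\<^sup>2 + 1) = 2 / ((norm w)\<^sup>2 + 1)"
      using arg_cong[OF eq, of snd] unfolding xy ht by linarith
    moreover have "(2 / ((norm v)\<^sup>2 + 1)) *\<^sub>R v = (2 / ((norm w)\<^sup>2 + 1)) *\<^sub>R w"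
      using arg_cong[OF eq, of fst] unfolding xy by simp
    ultimately have "(2 / ((norm v)\<^sup>2 + 1)) *\<^sub>R v = (2 / ((norm v)\<^sup>2 + 1)) *\<^sub>R w"
      by simp
    then show ?thesis
      using pos[of v] xy by simp
  next
    fix v assume xy: "x = Finite_Point v" "y = Infinity_Point"
    show ?thesis using ne[of v] eq unfolding xy by simp
  next
    fix w assume xy: "x = Infinity_Point" "y = Finite_Point w"
    show ?thesis using ne[of w] eq[symmetric] unfolding xy by simp
  qed simp
qed

lemma abs_inner_unit_le_1:
  fixes a b :: "'a::real_inner"
  assumes "norm a = 1" "norm b = 1"
  shows "- 1 \<le> a \<bullet> b" "a \<bullet> b \<le> 1"
  using Cauchy_Schwarz_ineq2[of a b] assms by auto

lemma arccos_inner_triangle: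
  fixes a b c :: "'a::real_inner"
  assumes "norm a = 1" "norm b = 1" "norm c = 1"
  shows "arccos (a \<bullet> c) \<le> arccos (a \<bullet> b) + arccos (b \<bullet> c)"
proof (cases "arccos (a \<bullet> b) + arccos (b \<bullet> c) \<le> pi")
  case True
  define s where "s = a \<bullet> b"
  define t where "t = b \<bullet> c"
  have st: "- 1 \<le> s" "s \<le> 1" "- 1 \<le> t" "t \<le> 1"
    using abs_inner_unit_le_1 assms by (auto simp: s_def t_def)
  have n: "a \<bullet> a = 1" "b \<bullet> b = 1" "c \<bullet> c = 1"
    using assms by (auto simp: norm_eq_1)
  have na: "norm (a - s *\<^sub>R b) = sqrt (1 - s\<^sup>2)"
    by (simp add: norm_eq_sqrt_inner inner_diff_left inner_diff_right n inner_commute[of b a]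
        power2_eq_square flip: s_def)
  have nc: "norm (c - t *\<^sub>R b) = sqrt (1 - t\<^sup>2)"
    by (simp add: norm_eq_sqrt_inner inner_diff_left inner_diff_right n inner_commute[of c b]
        power2_eq_square flip: t_def)
  have "a \<bullet> c = s * t + (a - s *\<^sub>R b) \<bullet> (c - t *\<^sub>R b)"
    by (simp add: inner_diff_left inner_diff_right n algebra_simps flip: s_def t_def)
  moreover have "(a - s *\<^sub>R b) \<bullet> (c - t *\<^sub>R b) \<ge> - (sqrt (1 - s\<^sup>2) * sqrt (1 - t\<^sup>2))"
    using Cauchy_Schwarz_ineq2[of "a - s *\<^sub>R b" "c - t *\<^sub>R b"] unfolding na nc by linarith
  ultimately have "cos (arccos s + arccos t) \<le> a \<bullet> c"
    using st by (simp add: cos_add sin_arccos_abs abs_le_iff)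
  moreover have "0 \<le> arccos s + arccos t"
    using st by (simp add: arccos_lbound)
  ultimately show ?thesis
    using True arccos_le_arccos[of "cos (arccos s + arccos t)" "a \<bullet> c"]
      abs_inner_unit_le_1[OF assms(1,3)]
    by (simp add: arccos_cos flip: s_def t_def)
next
  case False
  then show ?thesis
    using arccos_ubound[of "a \<bullet> c"] abs_inner_unit_le_1[OF assms(1,3)] by linarith
qed

lemma arccos_inner_eq_0_iff:
  fixes a b :: "'a::real_inner"
  assumes "norm a = 1" "norm b = 1"
  shows "arccos (a \<bullet> b) = 0 \<longleftrightarrow> a = b"
proof
  assume "arccos (a \<bullet> b) = 0"
  then have "a \<bullet> b = 1"
    using abs_inner_unit_le_1[OF assms] by (metis cos_arccos cos_zero)
  then have "(a - b) \<bullet> (a - b) = 0"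
    using assms by (simp add: inner_diff_left inner_diff_right inner_commute norm_eq_1)
  then show "a = b"
    by simp
next
  assume "a = b"
  then show "arccos (a \<bullet> b) = 0"
    using assms by (simp add: norm_eq_1)
qed

text \<open>The distance is the great-circle distance of the images on the unit sphere. It is
  uniformly equivalent to the chordal distance \<open>dist (to_sphere x) (to_sphere y)\<close>.\<close>

instantiation one_point :: (real_inner) metric_space
begin

definition dist_one_point :: "'a one_point \<Rightarrow> 'a one_point \<Rightarrow> real" where
  "dist_one_point x y = arccos (to_sphere x \<bullet> to_sphere y)"

definition uniformity_one_point :: "('a one_point \<times> 'a one_point) filter" where
  "uniformity_one_point = (INF e\<in>{0<..}. principal {(x, y). dist x y < e})"

definition open_one_point :: "'a one_point set \<Rightarrow> bool" where
  "open_one_point U \<longleftrightarrow> (\<forall>x\<in>U. eventually (\<lambda>(x', y). x' = x \<longrightarrow> y \<in> U) uniformity)"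

instance
proof
  fix x y z :: "'a one_point"
  show "dist x y = 0 \<longleftrightarrow> x = y"
    by (simp add: dist_one_point_def arccos_inner_eq_0_iff norm_to_sphere
        inj_eq[OF inj_to_sphere])
  show "dist x y \<le> dist x z + dist y z"
    using arccos_inner_triangle[of "to_sphere x" "to_sphere z" "to_sphere y"]
    by (simp add: dist_one_point_def norm_to_sphere inner_commute)
qed (simp_all add: uniformity_one_point_def open_one_point_def)

end

end

theory Submission
  imports Defs
begin

text \<open>The spherical continuity at the boundary comes from Sturm comparison along the radii of the
  disk. For a curve \<open>f\<close> in a Euclidean space and a point \<open>a\<close>, the function
  \<open>u = norm (f - a) / sqrt (norm f')\<close> satisfies \<open>u'' \<ge> - (S / 2) u\<close>, where \<open>S\<close> is Ahlfors' real
  Schwarzian of \<open>f\<close>; the difference is a square (\<open>schwarzian_square_completion\<close>). For the radial curve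
  \<open>f x = \<phi> (x \<zeta>)\<close>, the hypothesis on the Schwarzian and the curvature implies \<open>S \<le> 2 p\<close>
  (\<open>immersed_curve.real_schwarzian_le\<close>). So \<open>u\<close> can be compared with a solution \<open>U\<close> of \<open>U'' + p U = 0\<close>.

  Since \<open>p\<close> is even and the equation is disconjugate, the even solution with \<open>U 0 = 1\<close> is positive
  (\<open>nehari_positive_solution\<close>). Then \<open>u / U\<close> is convex as a function of \<open>F = \<integral> 1 / U\<^sup>2\<close>. If its slope at
  \<open>0\<close> is positive, it grows at least linearly, and the speed \<open>1 / u\<^sup>2\<close> of the curve inverted at \<open>a\<close>
  is bounded by the derivative of a bounded function of the form \<open>- const / (1 + F)\<close>, even if
  \<open>F\<close> is unbounded (\<open>sturm_comparison_of_curve\<close>). The slope is made positive by the choice of \<open>a\<close>: a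
  point slightly behind \<open>\<phi> 0\<close>, seen in the direction of a given boundary point \<open>\<zeta>0\<close>. The same \<open>a\<close>
  serves a whole sector around \<open>\<zeta>0\<close> (\<open>immersed_curve.slope_at_center\<close>). Inversion changes the spherical
  metric by a bounded factor only, hence in each such sector the stereographic image of \<open>\<phi>\<close> converges
  uniformly along the radii (\<open>radial_modulus\<close>).

  Uniform radial convergence, together with continuity on smaller circles, gives a Cauchy criterion
  at each boundary point; compactness of the closed disk turns it into uniform continuity, and the
  extension exists because the sphere is complete.\<close>

section \<open>Positive solutions of a disconjugate linear equation\<close>

lemma antiderivative_vanishing_at_0:
  fixes f :: "real \<Rightarrow> real"
  assumes "continuous_on {-1<..<1} f"
  shows "\<exists>F. F 0 = 0 \<and> (\<forall>x\<in>{-1<..<1}. (F has_real_derivative f x) (at x))"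
proof -
  have "isCont f x" if "ereal (-1) < ereal x" "ereal x < ereal 1" for x
    using that assms by (simp add: continuous_on_eq_continuous_at)
  then obtain F where F: "\<And>x. -1 < x \<Longrightarrow> x < 1 \<Longrightarrow> (F has_vector_derivative f x) (at x)"
    using einterval_antiderivative[of "ereal (-1)" "ereal 1" f] by auto
  then have "((\<lambda>x. F x - F 0) has_real_derivative f x) (at x)" if "x \<in> {-1<..<1}" for x
    using that by (auto intro!: derivative_eq_intros simp: has_real_derivative_iff_has_vector_derivative)
  then show ?thesis
    by (intro exI[of _ "\<lambda>x. F x - F 0"]) auto
qed

text \<open>The gain of one power of \<open>\<bar>x\<bar>\<close> and of a factor \<open>1 / Suc k\<close> per integration is what
  makes the Picard series of a linear equation converge on the whole interval, however large the
  coefficient is near the endpoints.\<close>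

lemma antiderivative_power_bound:
  fixes F f :: "real \<Rightarrow> real"
  assumes "F 0 = 0"
    and "\<And>x. \<bar>x\<bar> \<le> b \<Longrightarrow> (F has_real_derivative f x) (at x)"
    and "\<And>x. \<bar>x\<bar> \<le> b \<Longrightarrow> \<bar>f x\<bar> \<le> C * \<bar>x\<bar> ^ k"
    and "\<bar>x\<bar> \<le> b"
  shows "\<bar>F x\<bar> \<le> C * \<bar>x\<bar> ^ Suc k / Suc k"
proof -
  have *: "\<bar>H y\<bar> \<le> C * y ^ Suc k / Suc k"
    if H: "H 0 = 0" "\<And>x. 0 \<le> x \<Longrightarrow> x \<le> b \<Longrightarrow> (H has_real_derivative h x) (at x)"
      "\<And>x. 0 \<le> x \<Longrightarrow> x \<le> b \<Longrightarrow> \<bar>h x\<bar> \<le> C * x ^ k" and y: "0 \<le> y" "y \<le> b"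
    for H h :: "real \<Rightarrow> real" and y
  proof (cases "y = 0")
    case False
    have "norm (H y - H 0) \<le> C * y ^ Suc k / Suc k - C * 0 ^ Suc k / Suc k"
    proof (rule differentiable_bound_general[where f' = h and \<phi>' = "\<lambda>x. C * x ^ k"])
      show "continuous_on {0..y} H"
        using H(2) y by (intro DERIV_continuous_on[of _ _ h]) (auto intro: has_field_derivative_at_within)
      show "((\<lambda>x. C * x ^ Suc k / Suc k) has_vector_derivative C * x ^ k) (at x)" for x
        using DERIV_cmult[OF DERIV_pow[of "Suc k" x], of "C / Suc k"]
        by (simp flip: has_real_derivative_iff_has_vector_derivative)
    qed (use H y False in \<open>auto intro!: continuous_intros simp: simp flip: has_real_derivative_iff_has_vector_derivative\<close>)
    then show ?thesis using H(1) by simp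
  qed (use H in simp)
  show ?thesis
  proof (cases "0 \<le> x")
    case True
    have "\<bar>F x\<bar> \<le> C * x ^ Suc k / Suc k"
    proof (rule *[of F f])
      show "\<bar>f t\<bar> \<le> C * t ^ k" if "0 \<le> t" "t \<le> b" for t
        using assms(3)[of t] that by simp
    qed (use assms True in auto)
    then show ?thesis
      using True by simp
  next
    case False
    have "((\<lambda>x. F (- x)) has_real_derivative - f (- y)) (at y)" if "0 \<le> y" "y \<le> b" for y
    proof -
      have "(F has_real_derivative f (- y)) (at (- y))"
        using assms(2)[of "- y"] that by simp
      then show ?thesis
        using DERIV_mirror by blast
    qed
    moreover have "\<bar>- f (- y)\<bar> \<le> C * y ^ k" if "0 \<le> y" "y \<le> b" for y
      using assms(3)[of "- y"] that by simp
    ultimately show ?thesis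
      using *[of "\<lambda>x. F (- x)" "\<lambda>x. - f (- x)" "- x"] assms(1,4) False by simp
  qed
qed

definition antiderivative0 :: "(real \<Rightarrow> real) \<Rightarrow> real \<Rightarrow> real" where
  "antiderivative0 f =
     (SOME F. F 0 = 0 \<and> (\<forall>x\<in>{-1<..<1}. (F has_real_derivative f x) (at x)))"

lemma antiderivative0:
  assumes "continuous_on {-1<..<1} f"
  shows "antiderivative0 f 0 = 0"
    and "x \<in> {-1<..<1} \<Longrightarrow> (antiderivative0 f has_real_derivative f x) (at x)"
    and "continuous_on {-1<..<1} (antiderivative0 f)"
proof -
  have *: "antiderivative0 f 0 = 0 \<and>
      (\<forall>x\<in>{-1<..<1}. (antiderivative0 f has_real_derivative f x) (at x))"
    unfolding antiderivative0_def by (rule someI_ex[OF antiderivative_vanishing_at_0[OF assms]])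
  then show "antiderivative0 f 0 = 0"
    and "x \<in> {-1<..<1} \<Longrightarrow> (antiderivative0 f has_real_derivative f x) (at x)"
    by auto
  show "continuous_on {-1<..<1} (antiderivative0 f)"
    using * by (intro DERIV_continuous_on[of _ _ f]) (auto intro: has_field_derivative_at_within)
qed

text \<open>Writing \<open>u'' + p u = 0\<close> with \<open>u 0 = 1\<close>, \<open>u' 0 = 0\<close> as a fixed point of twofold integration,
  the solution is the sum of the iterates of \<open>u \<mapsto> - \<integral>\<integral> p u\<close> applied to the constant \<open>1\<close>. The
  derivatives of the terms are kept as a second sequence because the series is differentiated
  twice, termwise.\<close>

fun picard_term :: "(real \<Rightarrow> real) \<Rightarrow> nat \<Rightarrow> real \<Rightarrow> real" where
  "picard_term p 0 = (\<lambda>_. 1)"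
| "picard_term p (Suc k) = antiderivative0 (antiderivative0 (\<lambda>t. - p t * picard_term p k t))"

fun picard_slope :: "(real \<Rightarrow> real) \<Rightarrow> nat \<Rightarrow> real \<Rightarrow> real" where
  "picard_slope p 0 = (\<lambda>_. 0)"
| "picard_slope p (Suc k) = antiderivative0 (\<lambda>t. - p t * picard_term p k t)"

lemma continuous_on_picard_term:
  assumes "continuous_on {-1<..<1} p"
  shows "continuous_on {-1<..<1} (picard_term p k)"
  by (induction k) (auto intro!: antiderivative0(3) continuous_intros assms)

text \<open>Each term costs two integrations, which would give \<open>fact (2 * k)\<close> in the denominator. Since
  \<open>\<bar>x\<bar> < 1\<close>, one of the two can be wasted, and then terms and slopes have the same bound.\<close>

lemma picard_term_bound:
  assumes p: "continuous_on {-1<..<1} p" and b: "b < 1"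
    and M: "\<And>x. \<bar>x\<bar> \<le> b \<Longrightarrow> \<bar>p x\<bar> \<le> M" and x: "\<bar>x\<bar> \<le> b"
  shows "\<bar>picard_term p k x\<bar> \<le> M ^ k * \<bar>x\<bar> ^ k / fact k"
    and "\<bar>picard_slope p k x\<bar> \<le> M ^ k * \<bar>x\<bar> ^ k / fact k"
proof -
  have M0: "M \<ge> 0"
    using M[OF x] by linarith
  have in1: "y \<in> {-1<..<1}" if "\<bar>y\<bar> \<le> b" for y
    using that b by auto
  have slope: "\<bar>picard_slope p (Suc k) y\<bar> \<le> M ^ Suc k * \<bar>y\<bar> ^ Suc k / fact (Suc k)"
    if IH: "\<And>y. \<bar>y\<bar> \<le> b \<Longrightarrow> \<bar>picard_term p k y\<bar> \<le> M ^ k * \<bar>y\<bar> ^ k / fact k"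
      and y: "\<bar>y\<bar> \<le> b" for k y
  proof -
    have c: "continuous_on {-1<..<1} (\<lambda>t. - p t * picard_term p k t)"
      by (intro continuous_intros p continuous_on_picard_term)
    have "\<bar>picard_slope p (Suc k) y\<bar> \<le> (M * (M ^ k / fact k)) * \<bar>y\<bar> ^ Suc k / Suc k"
    proof (rule antiderivative_power_bound[where b = b and f = "\<lambda>t. - p t * picard_term p k t"])
      show "\<bar>- p t * picard_term p k t\<bar> \<le> M * (M ^ k / fact k) * \<bar>t\<bar> ^ k" if "\<bar>t\<bar> \<le> b" for t
        using mult_mono[OF M[OF that] IH[OF that]] M0 by (simp add: abs_mult)
    qed (use antiderivative0[OF c] in1 y in auto)
    then show ?thesis by (simp add: field_simps)
  qed
  have main: "\<bar>picard_term p k y\<bar> \<le> M ^ k * \<bar>y\<bar> ^ k / fact k" if "\<bar>y\<bar> \<le> b" for k y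
    using that
  proof (induction k arbitrary: y)
    case (Suc k)
    have c: "continuous_on {-1<..<1} (picard_slope p (Suc k))"
      by (auto intro!: antiderivative0(3) continuous_intros continuous_on_picard_term p)
    define C where "C = M ^ Suc k / fact (Suc k)"
    have C: "C \<ge> 0"
      using M0 by (simp add: C_def)
    have "\<bar>picard_term p (Suc k) y\<bar> \<le> C * \<bar>y\<bar> ^ Suc (Suc k) / Suc (Suc k)"
    proof (rule antiderivative_power_bound[where b = b and f = "picard_slope p (Suc k)"])
      show "\<bar>picard_slope p (Suc k) t\<bar> \<le> C * \<bar>t\<bar> ^ Suc k" if "\<bar>t\<bar> \<le> b" for t
        using slope[OF Suc.IH that] by (simp add: C_def)
    qed (use antiderivative0[OF c] in1 Suc.prems in auto)
    also have "\<dots> \<le> C * \<bar>y\<bar> ^ Suc (Suc k)"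
      using C divide_left_mono[of 1 "Suc (Suc k)" "C * \<bar>y\<bar> ^ Suc (Suc k)"] by simp
    also have "\<dots> \<le> C * \<bar>y\<bar> ^ Suc k"
      using C Suc.prems b by (intro mult_left_mono power_decreasing) auto
    finally show ?case by (simp add: C_def)
  qed simp
  show "\<bar>picard_term p k x\<bar> \<le> M ^ k * \<bar>x\<bar> ^ k / fact k"
    by (rule main[OF x])
  show "\<bar>picard_slope p k x\<bar> \<le> M ^ k * \<bar>x\<bar> ^ k / fact k"
    using slope[OF main x] by (cases k) auto
qed

text \<open>Disconjugacy speaks only about solutions that exist, so it becomes usable once solutions on
  the whole open interval are known to exist. On each compact subinterval the Picard series and its
  first two termwise derivatives are dominated by an exponential series.\<close>

lemma linear_ode_solution:
  fixes p :: "real \<Rightarrow> real"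
  assumes p: "continuous_on {-1<..<1} p"
  obtains U V :: "real \<Rightarrow> real" where "U 0 = 1" "V 0 = 0"
    "\<And>x. x \<in> {-1<..<1} \<Longrightarrow> (U has_real_derivative V x) (at x)"
    "\<And>x. x \<in> {-1<..<1} \<Longrightarrow> (V has_real_derivative - p x * U x) (at x)"
proof -
  define dslope where "dslope k x = (case k of 0 \<Rightarrow> 0 | Suc j \<Rightarrow> - p x * picard_term p j x)" for k x
  have cS: "continuous_on {-1<..<1} (\<lambda>t. - p t * picard_term p k t)" for k
    by (intro continuous_intros p continuous_on_picard_term)
  have dterm: "(picard_term p k has_real_derivative picard_slope p k x) (at x)"
    if "x \<in> {-1<..<1}" for k x
    using antiderivative0(2)[OF antiderivative0(3)[OF cS] that] by (cases k) auto
  have dslope: "(picard_slope p k has_real_derivative dslope k x) (at x)"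
    if "x \<in> {-1<..<1}" for k x
    using antiderivative0(2)[OF cS that] by (cases k) (auto simp: dslope_def)
  have term0: "picard_term p k 0 = (if k = 0 then 1 else 0)" for k
    using antiderivative0(1)[OF antiderivative0(3)[OF cS]] by (cases k) auto
  have slope0: "picard_slope p k 0 = 0" for k
    using antiderivative0(1)[OF cS] by (cases k) auto
  define U where "U x = (\<Sum>k. picard_term p k x)" for x
  define V where "V x = (\<Sum>k. picard_slope p k x)" for x
  have main: "(U has_real_derivative V x) (at x) \<and> (V has_real_derivative - p x * U x) (at x)"
    if x: "x \<in> {-1<..<1}" for x
  proof -
    \<comment> \<open>A compact subinterval around \<open>0\<close> with \<open>x\<close> in its interior; \<open>p\<close> is bounded there.\<close>
    define b where "b = (1 + \<bar>x\<bar>) / 2"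
    have b: "\<bar>x\<bar> < b" "b < 1" "0 < b"
      using x by (auto simp: b_def)
    have sub: "{-b..b} \<subseteq> {-1<..<1}"
      using b by auto
    have "bounded (p ` {-b..b})"
      using continuous_on_subset[OF p sub]
      by (intro compact_imp_bounded compact_continuous_image) auto
    then obtain M where "\<And>y. y \<in> {-b..b} \<Longrightarrow> \<bar>p y\<bar> \<le> M"
      unfolding bounded_iff by (metis image_eqI real_norm_def)
    then have M: "\<And>y. \<bar>y\<bar> \<le> b \<Longrightarrow> \<bar>p y\<bar> \<le> M"
      by (auto simp: abs_le_iff)
    have M0: "M \<ge> 0"
      using M[of 0] b by (simp add: order_trans[OF abs_ge_zero])
    define B where "B k = (M * b) ^ k / fact k" for k :: nat
    have sumB: "summable B"
      unfolding B_def using summable_exp[of "M * b"] by (simp add: field_simps)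
    have B: "\<bar>picard_term p k y\<bar> \<le> B k" "\<bar>picard_slope p k y\<bar> \<le> B k" if "y \<in> {-b..b}" for k y
    proof -
      have y: "\<bar>y\<bar> \<le> b" using that by auto
      have "M ^ k * \<bar>y\<bar> ^ k / fact k \<le> B k"
        using y M0 by (auto simp: B_def power_mult_distrib intro!: divide_right_mono mult_left_mono power_mono)
      then show "\<bar>picard_term p k y\<bar> \<le> B k" "\<bar>picard_slope p k y\<bar> \<le> B k"
        using picard_term_bound[OF p b(2) M y, of k] by auto
    qed
    have D: "\<bar>dslope k y\<bar> \<le> M * B (k - 1)" if "y \<in> {-b..b}" for k y
      using mult_mono[OF M[of y] B(1)[OF that, of "k - 1"]] M0 b that
      by (cases k) (auto simp: dslope_def abs_mult B_def)
    have sumD: "summable (\<lambda>k. M * B (k - 1))"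
      using sumB by (subst summable_Suc_iff[symmetric]) (simp add: summable_mult)
    have int: "x \<in> interior {-b..b}" using b by (simp add: interior_atLeastAtMost_real abs_less_iff) 
    have zero: "0 \<in> {-b..b}" using b by auto
    have dterm': "(picard_term p k has_real_derivative picard_slope p k y) (at y within {-b..b})"
      and dslope': "(picard_slope p k has_real_derivative dslope k y) (at y within {-b..b})"
      if "y \<in> {-b..b}" for k y
      using dterm[of y k] dslope[of y k] sub that by (blast intro: has_field_derivative_at_within)+
    have "(U has_real_derivative V x) (at x)"
      unfolding U_def V_def
    proof (rule has_field_derivative_series'(2)[OF _ _ _ zero _ int])
      show "uniformly_convergent_on {-b..b} (\<lambda>n y. \<Sum>k<n. picard_slope p k y)"
        by (rule Weierstrass_m_test'[OF _ sumB]) (use B in auto)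
      show "summable (\<lambda>k. picard_term p k 0)"
        by (rule summable_comparison_test'[OF sumB, of 0]) (use B(1)[OF zero] in auto)
    qed (use dterm' in auto)
    moreover have "(V has_real_derivative (\<Sum>k. dslope k x)) (at x)"
      unfolding V_def
    proof (rule has_field_derivative_series'(2)[OF _ _ _ zero _ int])
      show "uniformly_convergent_on {-b..b} (\<lambda>n y. \<Sum>k<n. dslope k y)"
        by (rule Weierstrass_m_test'[OF _ sumD]) (use D in auto)
    qed (use dslope' slope0 in auto)
    moreover have "(\<Sum>k. dslope k x) = - p x * U x"
    proof -
      have x': "x \<in> {-b..b}" using b by auto
      have s: "summable (\<lambda>k. picard_term p k x)"
        by (rule summable_comparison_test'[OF sumB, of 0]) (use B(1)[OF x'] in auto)
      have "(\<lambda>k. dslope (Suc k) x) sums (- p x * U x)"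
        using sums_mult[OF summable_sums[OF s], of "- p x"] by (simp add: dslope_def U_def)
      then have "(\<lambda>k. dslope k x) sums (- p x * U x)"
        by (rule sums_Suc_imp[rotated]) (simp add: dslope_def)
      then show ?thesis by (rule sums_unique[symmetric])
    qed
    ultimately show ?thesis by simp
  qed
  have "U 0 = 1"
    unfolding U_def term0 using sums_unique[OF sums_single[of 0 "\<lambda>_. 1::real"]] by simp
  moreover have "V 0 = 0"
    by (simp add: V_def slope0)
  ultimately show ?thesis
    using main by (intro that[of U V]) simp_all
qed

text \<open>Averaging a solution with its reflection makes it even, so that a zero would come with its
  mirror image and contradict disconjugacy.\<close>

lemma nehari_positive_solution:
  assumes "nehari_function p"
  obtains U V :: "real \<Rightarrow> real" where "U 0 = 1" "V 0 = 0"
    "\<And>x. x \<in> {-1<..<1} \<Longrightarrow> (U has_real_derivative V x) (at x)"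
    "\<And>x. x \<in> {-1<..<1} \<Longrightarrow> (V has_real_derivative - p x * U x) (at x)"
    "\<And>x. x \<in> {-1<..<1} \<Longrightarrow> U x > 0"
proof -
  have p: "continuous_on {-1<..<1} p" and even: "\<And>x. x \<in> {-1<..<1} \<Longrightarrow> p (- x) = p x"
    using assms by (auto simp: nehari_function_def)
  have dis: "\<And>u x y. \<lbrakk>solves_ode p u; \<exists>x\<in>{-1<..<1}. u x \<noteq> 0; x \<in> {-1<..<1}; y \<in> {-1<..<1};
      u x = 0; u y = 0\<rbrakk> \<Longrightarrow> x = y"
    using assms unfolding nehari_function_def by meson
  obtain U0 V0 where U0: "U0 0 = 1" "V0 0 = 0"
    and dU0: "\<And>x. x \<in> {-1<..<1} \<Longrightarrow> (U0 has_real_derivative V0 x) (at x)"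
    and dV0: "\<And>x. x \<in> {-1<..<1} \<Longrightarrow> (V0 has_real_derivative - p x * U0 x) (at x)"
    using linear_ode_solution[OF p] by metis
  define U where "U x = (U0 x + U0 (- x)) / 2" for x
  define V where "V x = (V0 x - V0 (- x)) / 2" for x
  have d: "((\<lambda>x. g (- x)) has_real_derivative - g' (- x)) (at x)"
    if "\<And>x. x \<in> {-1<..<1} \<Longrightarrow> (g has_real_derivative g' x) (at x)" "x \<in> {-1<..<1}"
    for g g' :: "real \<Rightarrow> real" and x
    using that(1)[of "- x"] that(2) DERIV_mirror by auto
  have dU: "(U has_real_derivative V x) (at x)" if "x \<in> {-1<..<1}" for x
    unfolding U_def V_def using d[OF dU0 that]
    by (auto intro!: derivative_eq_intros dU0[OF that])
  have dV: "(V has_real_derivative - p x * U x) (at x)" if "x \<in> {-1<..<1}" for x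
    unfolding U_def V_def using d[OF dV0 that] even[OF that]
    by (auto intro!: derivative_eq_intros dV0[OF that] simp: field_simps)
  have U1: "U 0 = 1" "V 0 = 0"
    using U0 by (auto simp: U_def V_def)
  have ode: "solves_ode p U"
    unfolding solves_ode_def using dU dV
    by (intro exI[of _ V] exI[of _ "\<lambda>x. - p x * U x"]) auto
  have nz: "U x \<noteq> 0" if x: "x \<in> {-1<..<1}" for x
  proof
    assume z: "U x = 0"
    then have "U (- x) = 0" by (simp add: U_def)
    moreover have "\<exists>x\<in>{-1<..<1}. U x \<noteq> 0"
      using U1 by (intro bexI[of _ 0]) auto
    ultimately have "x = - x"
      using dis[OF ode, of x "- x"] z x by simp
    then show False using z U1 by simp
  qed
  have pos: "U x > 0" if x: "x \<in> {-1<..<1}" for x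
  proof (rule ccontr)
    assume "\<not> U x > 0"
    moreover have "continuous_on {-1<..<1} U"
      using dU by (intro DERIV_continuous_on[of _ _ V]) (auto intro: has_field_derivative_at_within)
    then have "connected (U ` {-1<..<1})"
      by (intro connected_continuous_image) auto
    moreover have "0 \<in> {-1<..<1::real}" by simp
    ultimately have "0 \<in> U ` {-1<..<1}"
      using U1 x unfolding connected_iff_interval
      by (smt (verit) image_eqI)
    then show False using nz by auto
  qed
  show ?thesis
    by (rule that[of U V]) (use U1 dU dV pos in simp_all)
qed

section \<open>Sturm comparison for curves in Euclidean space\<close>

text \<open>Ahlfors' Schwarzian of a curve in Euclidean space with derivatives \<open>f1\<close>, \<open>f2\<close>, \<open>f3\<close>. For a curve
  on the real line it is the classical Schwarzian derivative.\<close>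

definition real_schwarzian :: "'a::real_inner \<Rightarrow> 'a \<Rightarrow> 'a \<Rightarrow> real" where
  "real_schwarzian f1 f2 f3 =
     (f1 \<bullet> f3) / (f1 \<bullet> f1) - 3 * (f1 \<bullet> f2)\<^sup>2 / (f1 \<bullet> f1)\<^sup>2 + 3 / 2 * (f2 \<bullet> f2) / (f1 \<bullet> f1)"

text \<open>The long expression is \<open>u'' / u\<close> for \<open>u = sqrt D / E powr (1/4)\<close>, where \<open>D\<close> is the squared
  distance of the curve from a point, here with \<open>X\<close> the vector from that point; \<open>D\<close> may exceed
  \<open>X \<bullet> X\<close> by a constant, as if the point lay off the space in an extra orthogonal direction.
  Let \<open>X'\<close> and \<open>f2'\<close> be the components of \<open>X\<close> and \<open>f2\<close> orthogonal to \<open>f1\<close>. The two sides differ by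
  the squared norm of \<open>(E / D) X' + f2' / 2\<close>, divided by \<open>E\<close>, and a multiple of \<open>D - X \<bullet> X\<close>.\<close>

lemma schwarzian_square_completion:
  fixes X f1 f2 f3 :: "'a::real_inner"
  assumes "f1 \<noteq> 0" and D: "D > 0" "X \<bullet> X \<le> D"
  defines "E \<equiv> f1 \<bullet> f1" and "b \<equiv> f1 \<bullet> f2"
  shows "(X \<bullet> f2 + E) / D - (X \<bullet> f1)\<^sup>2 / D\<^sup>2 - (X \<bullet> f1) * b / (D * E)
      - (f2 \<bullet> f2 + f1 \<bullet> f3) / (2 * E) + 5 * b\<^sup>2 / (4 * E\<^sup>2)
    \<ge> - real_schwarzian f1 f2 f3 / 2"
proof -
  have E: "E > 0"
    using assms by simp
  define Y where "Y = (E / D) *\<^sub>R (X - ((X \<bullet> f1) / E) *\<^sub>R f1) + (1/2) *\<^sub>R (f2 - (b / E) *\<^sub>R f1)"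
  have comm: "f1 \<bullet> X = X \<bullet> f1" "f2 \<bullet> X = X \<bullet> f2" "f2 \<bullet> f1 = b" "f1 \<bullet> f2 = b" "f1 \<bullet> f1 = E"
    by (simp_all add: inner_commute b_def E_def)
  have Y1: "Y \<bullet> Y = (E / D)\<^sup>2 * (X \<bullet> X - (X \<bullet> f1)\<^sup>2 / E) + (E / D) * (X \<bullet> f2 - b * (X \<bullet> f1) / E)
      + (1/4) * (f2 \<bullet> f2 - b\<^sup>2 / E)"
    unfolding Y_def inner_add_left inner_add_right inner_diff_left inner_diff_right
      inner_scaleR_left inner_scaleR_right comm
    using E D by (simp add: field_simps power2_eq_square)
  have "0 \<le> Y \<bullet> Y / E + (E / D\<^sup>2) * (D - X \<bullet> X)"
    using E D by (intro add_nonneg_nonneg mult_nonneg_nonneg divide_nonneg_pos) auto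
  also have "\<dots> = (X \<bullet> f2 + E) / D - (X \<bullet> f1)\<^sup>2 / D\<^sup>2 - (X \<bullet> f1) * b / (D * E)
      + (f2 \<bullet> f2) / (4 * E) - b\<^sup>2 / (4 * E\<^sup>2)"
    unfolding Y1 using E D by (simp add: field_simps power2_eq_square)
  also have "\<dots> = (X \<bullet> f2 + E) / D - (X \<bullet> f1)\<^sup>2 / D\<^sup>2 - (X \<bullet> f1) * b / (D * E)
      - (f2 \<bullet> f2 + f1 \<bullet> f3) / (2 * E) + 5 * b\<^sup>2 / (4 * E\<^sup>2) + real_schwarzian f1 f2 f3 / 2"
    unfolding real_schwarzian_def comm using E D by (simp add: field_simps power2_eq_square)
  finally show ?thesis by linarith
qed

lemma DERIV_inner_curves:
  fixes f g :: "real \<Rightarrow> 'a::real_inner"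
  assumes "(f has_vector_derivative f') (at x)" "(g has_vector_derivative g') (at x)"
  shows "((\<lambda>x. f x \<bullet> g x) has_real_derivative (f x \<bullet> g' + f' \<bullet> g x)) (at x)"
  using bounded_bilinear.has_vector_derivative[OF bounded_bilinear_inner assms]
  by (simp add: has_real_derivative_iff_has_vector_derivative)

text \<open>The function \<open>u = sqrt (D / norm f1)\<close> satisfies \<open>u'' + p u \<ge> 0\<close>, so its Wronskian with the
  solution \<open>U\<close> of \<open>U'' + p U = 0\<close> is nondecreasing. As the Wronskian is at least \<open>w0 = u 0\<close> at \<open>0\<close>, the
  derivative of \<open>u / U\<close> is at least \<open>w0 / U\<^sup>2 = w0 F'\<close>, and \<open>u / U\<close> grows at least linearly in \<open>F\<close>. The
  left side of the conclusion is \<open>1 / u\<^sup>2\<close>: the speed of the curve after inversion at \<open>a\<close>, up to the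
  harmless \<open>\<eta>\<close>. The right side has the bounded primitive \<open>- 1 / (w0\<^sup>2 (1 + F))\<close>, also when \<open>F\<close> itself is
  unbounded; this is what the positive initial slope buys. The constant \<open>\<eta> > 0\<close> keeps \<open>D\<close> away
  from \<open>0\<close>, so that it does not matter whether the curve meets \<open>a\<close>.\<close>

lemma sturm_comparison_of_curve:
  fixes f f1 f2 f3 :: "real \<Rightarrow> 'a::real_inner" and p U V F :: "real \<Rightarrow> real"
  assumes df: "\<And>x. x \<in> {0..<1} \<Longrightarrow> (f has_vector_derivative f1 x) (at x)"
    and df1: "\<And>x. x \<in> {0..<1} \<Longrightarrow> (f1 has_vector_derivative f2 x) (at x)"
    and df2: "\<And>x. x \<in> {0..<1} \<Longrightarrow> (f2 has_vector_derivative f3 x) (at x)"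
    and f1: "\<And>x. x \<in> {0..<1} \<Longrightarrow> f1 x \<noteq> 0"
    and S: "\<And>x. x \<in> {0..<1} \<Longrightarrow> real_schwarzian (f1 x) (f2 x) (f3 x) \<le> 2 * p x"
    and U0: "U 0 = 1" "V 0 = 0"
    and dU: "\<And>x. x \<in> {0..<1} \<Longrightarrow> (U has_real_derivative V x) (at x)"
    and dV: "\<And>x. x \<in> {0..<1} \<Longrightarrow> (V has_real_derivative - p x * U x) (at x)"
    and U: "\<And>x. x \<in> {0..<1} \<Longrightarrow> U x > 0"
    and F0: "F 0 = 0" and dF: "\<And>x. x \<in> {0..<1} \<Longrightarrow> (F has_real_derivative 1 / (U x)\<^sup>2) (at x)"
    and \<eta>: "\<eta> > 0"
    and slope: "(f 0 - a) \<bullet> f1 0 / ((norm (f 0 - a))\<^sup>2 + \<eta>\<^sup>2) - f1 0 \<bullet> f2 0 / (2 * (norm (f1 0))\<^sup>2) \<ge> 1"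
    and w0: "w0 = sqrt (((norm (f 0 - a))\<^sup>2 + \<eta>\<^sup>2) / norm (f1 0))"
    and x: "x \<in> {0..<1}"
  shows "norm (f1 x) / ((norm (f x - a))\<^sup>2 + \<eta>\<^sup>2) \<le> 1 / (U x * (w0 + w0 * F x))\<^sup>2"
proof -
  define D where "D x = (f x - a) \<bullet> (f x - a) + \<eta>\<^sup>2" for x
  define E where "E x = f1 x \<bullet> f1 x" for x
  \<comment> \<open>\<open>L\<close> is the logarithmic derivative of \<open>u\<close>, and \<open>L'\<close> is its derivative.\<close>
  define L where "L x = ((f x - a) \<bullet> f1 x) / D x - (f1 x \<bullet> f2 x) / (2 * E x)" for x
  define u where "u x = exp (ln (D x) / 2 - ln (E x) / 4)" for x
  define L' where "L' x = ((f x - a) \<bullet> f2 x + E x) / D x - 2 * ((f x - a) \<bullet> f1 x)\<^sup>2 / (D x)\<^sup>2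
     - (f2 x \<bullet> f2 x + f1 x \<bullet> f3 x) / (2 * E x) + (f1 x \<bullet> f2 x)\<^sup>2 / (E x)\<^sup>2" for x
  have D: "D x > 0" for x
    using \<eta> by (simp add: D_def add_nonneg_pos)
  have E: "E x > 0" if "x \<in> {0..<1}" for x
    using f1[OF that] by (simp add: E_def)
  have df': "((\<lambda>x. f x - a) has_vector_derivative f1 x) (at x)" if "x \<in> {0..<1}" for x
    using df[OF that] by (auto intro!: derivative_eq_intros)
  have dD: "(D has_real_derivative 2 * ((f x - a) \<bullet> f1 x)) (at x)" if "x \<in> {0..<1}" for x
    unfolding D_def
    by (auto intro!: derivative_eq_intros DERIV_inner_curves[OF df'[OF that] df'[OF that]]
        simp: inner_commute)
  have dE: "(E has_real_derivative 2 * (f1 x \<bullet> f2 x)) (at x)" if "x \<in> {0..<1}" for x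
    unfolding E_def using DERIV_inner_curves[OF df1[OF that] df1[OF that]]
    by (simp add: inner_commute)
  have du: "(u has_real_derivative u x * L x) (at x)" if "x \<in> {0..<1}" for x
    unfolding u_def L_def using D[of x] E[OF that]
    by (auto intro!: derivative_eq_intros dD[OF that] dE[OF that] simp: field_simps)
  have dL: "(L has_real_derivative L' x) (at x)" if "x \<in> {0..<1}" for x
    unfolding L_def L'_def using D[of x] E[OF that]
    by (auto intro!: derivative_eq_intros dD[OF that] dE[OF that]
        DERIV_inner_curves[OF df'[OF that] df1[OF that]] DERIV_inner_curves[OF df1[OF that] df2[OF that]]
        simp flip: E_def)
      (simp add: field_simps power2_eq_square)
  \<comment> \<open>This is \<open>u'' + p u \<ge> 0\<close>, divided by \<open>u\<close>.\<close>
  have ric: "L' x + (L x)\<^sup>2 + p x \<ge> 0" if "x \<in> {0..<1}" for x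
  proof -
    have "L' x + (L x)\<^sup>2 = ((f x - a) \<bullet> f2 x + E x) / D x - ((f x - a) \<bullet> f1 x)\<^sup>2 / (D x)\<^sup>2
        - ((f x - a) \<bullet> f1 x) * (f1 x \<bullet> f2 x) / (D x * E x)
        - (f2 x \<bullet> f2 x + f1 x \<bullet> f3 x) / (2 * E x) + 5 * (f1 x \<bullet> f2 x)\<^sup>2 / (4 * (E x)\<^sup>2)"
      unfolding L_def L'_def using D[of x] E[OF that] by (simp add: field_simps power2_eq_square)
    also have "\<dots> \<ge> - real_schwarzian (f1 x) (f2 x) (f3 x) / 2"
      unfolding E_def by (rule schwarzian_square_completion[OF f1[OF that] D]) (simp add: D_def)
    finally have "- real_schwarzian (f1 x) (f2 x) (f3 x) / 2 \<le> L' x + (L x)\<^sup>2" .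
    then show ?thesis using S[OF that] by linarith
  qed
  \<comment> \<open>\<open>N\<close> is the Wronskian \<open>u' U - u U'\<close>.\<close>
  define w where "w x = u x / U x" for x
  define N where "N x = u x * (L x * U x - V x)" for x
  have u: "u x > 0" for x by (simp add: u_def)
  have dw: "(w has_real_derivative N x * (1 / (U x)\<^sup>2)) (at x)" if "x \<in> {0..<1}" for x
    unfolding w_def N_def using U[OF that]
    by (auto intro!: derivative_eq_intros du[OF that] dU[OF that] simp: field_simps power2_eq_square)
  have dN: "(N has_real_derivative u x * U x * (L' x + (L x)\<^sup>2 + p x)) (at x)" if "x \<in> {0..<1}" for x
    unfolding N_def
    by (auto intro!: derivative_eq_intros du[OF that] dL[OF that] dU[OF that] dV[OF that])
      (simp add: algebra_simps power2_eq_square)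
  have u2: "(u x)\<^sup>2 = D x / norm (f1 x)" if "x \<in> {0..<1}" for x
  proof -
    have "(u x)\<^sup>2 = exp (ln (D x) - ln (E x) / 2)"
      by (simp add: u_def flip: exp_double)
    also have "\<dots> = D x / sqrt (E x)"
      using D[of x] E[OF that] by (simp add: exp_diff ln_sqrt[symmetric])
    finally show ?thesis by (simp add: E_def norm_eq_sqrt_inner)
  qed
  have u0: "u 0 = w0"
    using u2[of 0] u[of 0] unfolding w0 D_def power2_norm_eq_inner
    by (metis atLeastLessThan_iff less_eq_real_def real_sqrt_unique zero_less_one order_refl)
  have w0pos: "w0 > 0"
    using u[of 0] u0 by simp
  have N: "N y \<ge> w0" if y: "y \<in> {0..<1}" for y
  proof -
    have "w0 \<le> N 0"
      using slope w0pos U0 unfolding N_def u0 L_def D_def E_def power2_norm_eq_inner by simp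
    also have "N 0 \<le> N y"
    proof (rule DERIV_nonneg_imp_nondecreasing[where f = N])
      fix t assume "0 \<le> t" "t \<le> y"
      then have t: "t \<in> {0..<1}" using y by simp
      show "\<exists>d. (N has_real_derivative d) (at t) \<and> d \<ge> 0"
        using dN[OF t] mult_nonneg_nonneg[OF mult_nonneg_nonneg ric[OF t], of "u t" "U t"] u[of t] U[OF t]
        by (meson less_imp_le)
    qed (use y in auto)
    finally show ?thesis .
  qed
  have F: "F x \<ge> 0"
  proof -
    have "F 0 \<le> F x"
    proof (rule DERIV_nonneg_imp_nondecreasing[where f = F])
      fix t assume "0 \<le> t" "t \<le> x"
      then show "\<exists>d. (F has_real_derivative d) (at t) \<and> d \<ge> 0"
        using dF[of t] x by (intro exI[of _ "1 / (U t)\<^sup>2"]) auto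
    qed (use x in auto)
    then show ?thesis using F0 by simp
  qed
  have "w 0 - w0 * F 0 \<le> w x - w0 * F x"
  proof (rule DERIV_nonneg_imp_nondecreasing[where f = "\<lambda>x. w x - w0 * F x"])
    fix t assume "0 \<le> t" "t \<le> x"
    then have t: "t \<in> {0..<1}" using x by simp
    have "((\<lambda>x. w x - w0 * F x) has_real_derivative (N t - w0) * (1 / (U t)\<^sup>2)) (at t)"
      by (auto intro!: derivative_eq_intros dw[OF t] dF[OF t] simp: algebra_simps diff_divide_distrib)
    then show "\<exists>d. ((\<lambda>x. w x - w0 * F x) has_real_derivative d) (at t) \<and> d \<ge> 0"
      using N[OF t] by (intro exI[of _ "(N t - w0) * (1 / (U t)\<^sup>2)"]) auto
  qed (use x in auto)
  then have "w0 + w0 * F x \<le> w x"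
    using F0 U0 u0 by (simp add: w_def)
  then have "U x * (w0 + w0 * F x) \<le> u x"
    using U[OF x] by (simp add: w_def field_simps)
  moreover have "U x * (w0 + w0 * F x) > 0"
    using U[OF x] w0pos F by (simp add: add_pos_nonneg)
  ultimately have "1 / (u x)\<^sup>2 \<le> 1 / (U x * (w0 + w0 * F x))\<^sup>2"
    using u[of x] by (intro divide_left_mono power_mono mult_pos_pos) auto
  then show ?thesis
    using u2[OF x] by (simp add: D_def power2_norm_eq_inner)
qed

section \<open>Schwarzian and curvature of a holomorphic curve\<close>

definition hermitian :: "complex ^ 'n \<Rightarrow> complex ^ 'n \<Rightarrow> complex" where
  "hermitian a b = (\<Sum>i\<in>UNIV. a $ i * cnj (b $ i))"

lemma Re_hermitian: "Re (hermitian a b) = a \<bullet> b"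
  by (simp add: hermitian_def inner_vec_def inner_complex_def)

lemma hermitian_self: "hermitian a a = of_real (a \<bullet> a)"
  by (simp add: complex_eq_iff Re_hermitian) (simp add: hermitian_def)

lemma hermitian_smult: "hermitian (c *s a) (d *s b) = c * cnj d * hermitian a b"
  by (simp add: hermitian_def sum_distrib_left mult_ac)

lemma hermitian_commute: "hermitian b a = cnj (hermitian a b)"
  by (simp add: hermitian_def mult.commute)

lemma inner_smult: "(c *s a) \<bullet> (d *s b) = Re (c * cnj d * hermitian a b)"
  by (simp flip: Re_hermitian add: hermitian_smult)

lemma curve_holomorphic_on_deriv:
  assumes "curve_holomorphic_on \<phi> S" "open S"
  shows "curve_holomorphic_on (curve_deriv \<phi>) S"
  using assms by (auto simp: curve_holomorphic_on_def curve_deriv_def intro: holomorphic_deriv)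

lemma curve_component_has_vector_derivative:
  fixes c :: "real \<Rightarrow> complex"
  assumes "curve_holomorphic_on \<phi> S" "open S" "c t \<in> S" "(c has_vector_derivative c') (at t)"
  shows "((\<lambda>t. \<phi> (c t) $ i) has_vector_derivative c' * curve_deriv \<phi> (c t) $ i) (at t)"
proof -
  have "((\<lambda>w. \<phi> w $ i) has_field_derivative curve_deriv \<phi> (c t) $ i) (at (c t))"
    using assms by (auto simp: curve_holomorphic_on_def curve_deriv_def intro: holomorphic_derivI)
  from field_vector_diff_chain_at[OF assms(4) this] show ?thesis
    by (simp add: o_def)
qed

lemma has_vector_derivative_componentwise:
  fixes f :: "real \<Rightarrow> complex ^ 'n"
  assumes "\<And>i. ((\<lambda>t. f t $ i) has_vector_derivative f' $ i) (at t)"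
  shows "(f has_vector_derivative f') (at t)"
  unfolding has_vector_derivative_def
proof (subst has_derivative_componentwise_within, intro ballI)
  fix b :: "complex ^ 'n" assume "b \<in> Basis"
  then obtain i e where b: "b = axis i e"
    by (auto simp: Basis_vec_def)
  have "((\<lambda>t. f t $ i \<bullet> e) has_derivative (\<lambda>h. (h *\<^sub>R f' $ i) \<bullet> e)) (at t)"
    using assms[of i] unfolding has_vector_derivative_def by (rule has_derivative_inner_left)
  then show "((\<lambda>t. f t \<bullet> b) has_derivative (\<lambda>h. (h *\<^sub>R f') \<bullet> b)) (at t)"
    by (simp add: b inner_axis)
qed

lemma curve_has_vector_derivative:
  fixes c :: "real \<Rightarrow> complex"
  assumes "curve_holomorphic_on \<phi> S" "open S" "c t \<in> S" "(c has_vector_derivative c') (at t)"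
  shows "((\<lambda>t. \<phi> (c t)) has_vector_derivative c' *s curve_deriv \<phi> (c t)) (at t)"
  by (rule has_vector_derivative_componentwise)
    (use curve_component_has_vector_derivative[OF assms] in simp)

lemma hermitian_has_vector_derivative:
  fixes c :: "real \<Rightarrow> complex"
  assumes \<phi>: "curve_holomorphic_on \<phi> S" and \<psi>: "curve_holomorphic_on \<psi> S"
    and S: "open S" "c t \<in> S" and c: "(c has_vector_derivative c') (at t)"
  shows "((\<lambda>t. hermitian (\<phi> (c t)) (\<psi> (c t))) has_vector_derivative
      c' * hermitian (curve_deriv \<phi> (c t)) (\<psi> (c t))
        + cnj c' * hermitian (\<phi> (c t)) (curve_deriv \<psi> (c t))) (at t)"
proof -
  have "((\<lambda>t. \<Sum>i\<in>UNIV. \<phi> (c t) $ i * cnj (\<psi> (c t) $ i)) has_vector_derivative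
      (\<Sum>i\<in>UNIV. \<phi> (c t) $ i * cnj (c' * curve_deriv \<psi> (c t) $ i)
         + c' * curve_deriv \<phi> (c t) $ i * cnj (\<psi> (c t) $ i))) (at t)"
    by (intro has_vector_derivative_sum has_vector_derivative_mult has_vector_derivative_cnj
        curve_component_has_vector_derivative[OF \<phi> S c] curve_component_has_vector_derivative[OF \<psi> S c])
  then show ?thesis
    by (simp add: hermitian_def sum.distrib sum_distrib_left mult_ac add.commute)
qed

lemma has_vector_derivative_cong_on_line:
  assumes "((\<lambda>t. g (z + d * complex_of_real t)) has_vector_derivative D) (at 0)"
    and "open S" "z \<in> S" "\<And>w. w \<in> S \<Longrightarrow> f w = g w"
  shows "((\<lambda>t. f (z + d * complex_of_real t)) has_vector_derivative D) (at 0)"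
proof (rule has_vector_derivative_transform_within_open[OF assms(1)])
  show "open ((\<lambda>t. z + d * complex_of_real t) -` S)"
    by (intro open_vimage \<open>open S\<close> continuous_intros)
qed (use assms in auto)

lemmas has_vector_derivative_Re = bounded_linear.has_vector_derivative[OF bounded_linear_Re]

text \<open>For \<open>\<sigma> = log_speed \<phi>\<close>, the first two derivatives of \<open>\<sigma>\<close> are polynomials in the quotients \<open>A\<close>, \<open>B\<close>,
  \<open>C\<close> defined below: \<open>\<sigma>\<^sub>z = B / 2\<close>, \<open>\<sigma>\<^sub>z\<^sub>z = (C - B\<^sup>2) / 2\<close> and \<open>\<Delta>\<sigma> = 2 (A - \<bar>B\<bar>\<^sup>2)\<close>. The reason is that
  a derivative in \<open>z\<close> hits only the holomorphic first argument of the Hermitian form. All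
  derivatives are computed along lines \<open>z + d t\<close>, with \<open>d\<close> being \<open>1\<close> or \<open>\<i>\<close> in the end.\<close>

locale immersed_curve =
  fixes \<phi> :: "complex \<Rightarrow> complex ^ 'n" and S :: "complex set"
  assumes hol: "curve_holomorphic_on \<phi> S" and open_S: "open S"
    and immersed: "\<And>z. z \<in> S \<Longrightarrow> curve_deriv \<phi> z \<noteq> 0"
begin

abbreviation "\<phi>1 \<equiv> curve_deriv \<phi>"
abbreviation "\<phi>2 \<equiv> curve_deriv \<phi>1"
abbreviation "\<phi>3 \<equiv> curve_deriv \<phi>2"

definition E :: "complex \<Rightarrow> real" where "E z = \<phi>1 z \<bullet> \<phi>1 z"
definition A :: "complex \<Rightarrow> real" where "A z = (\<phi>2 z \<bullet> \<phi>2 z) / E z"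
definition B :: "complex \<Rightarrow> complex" where "B z = hermitian (\<phi>2 z) (\<phi>1 z) / of_real (E z)"
definition C :: "complex \<Rightarrow> complex" where "C z = hermitian (\<phi>3 z) (\<phi>1 z) / of_real (E z)"

lemma hol1: "curve_holomorphic_on \<phi>1 S"
  and hol2: "curve_holomorphic_on \<phi>2 S"
  using curve_holomorphic_on_deriv hol open_S by blast+

lemma E_pos: "z \<in> S \<Longrightarrow> E z > 0"
  using immersed by (simp add: E_def)

lemma hermitian_\<phi>2_\<phi>1: "z \<in> S \<Longrightarrow> hermitian (\<phi>2 z) (\<phi>1 z) = of_real (E z) * B z"
  and hermitian_\<phi>3_\<phi>1: "z \<in> S \<Longrightarrow> hermitian (\<phi>3 z) (\<phi>1 z) = of_real (E z) * C z"
  and inner_\<phi>2_\<phi>2: "z \<in> S \<Longrightarrow> \<phi>2 z \<bullet> \<phi>2 z = E z * A z"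
  using E_pos[of z] by (simp_all add: A_def B_def C_def)

lemma log_speed_eq: "log_speed \<phi> z = ln (E z) / 2"
  by (simp add: log_speed_def E_def inner_vec_def curve_deriv_def dot_square_norm)

lemma line_has_vector_derivative:
  "((\<lambda>t. z + d * complex_of_real t) has_vector_derivative d) (at t)"
  by (auto intro!: derivative_eq_intros)

lemma E_derivative:
  assumes "z \<in> S"
  shows "((\<lambda>t. E (z + d * of_real t)) has_vector_derivative 2 * E z * Re (d * B z)) (at 0)"
proof -
  have "((\<lambda>t. hermitian (\<phi>1 (z + d * of_real t)) (\<phi>1 (z + d * of_real t))) has_vector_derivative
      d * hermitian (\<phi>2 z) (\<phi>1 z) + cnj d * hermitian (\<phi>1 z) (\<phi>2 z)) (at 0)"
    using hermitian_has_vector_derivative[OF hol1 hol1 open_S _ line_has_vector_derivative, of z d 0] assms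
    by simp
  from has_vector_derivative_Re[OF this] show ?thesis
    by (simp add: hermitian_self hermitian_commute[of "\<phi>1 z" "\<phi>2 z"] hermitian_\<phi>2_\<phi>1[OF assms]
        E_def[symmetric] algebra_simps)
qed

lemma log_speed_derivative:
  assumes "z \<in> S"
  shows "((\<lambda>t. log_speed \<phi> (z + d * of_real t)) has_vector_derivative Re (d * B z)) (at 0)"
proof -
  define r where "r = Re (d * B z)"
  have "((\<lambda>t. ln (E (z + d * of_real t)) / 2) has_real_derivative r) (at 0)"
    using E_derivative[OF assms, of d, folded has_real_derivative_iff_has_vector_derivative r_def] E_pos[OF assms]
    by (auto intro!: derivative_eq_intros)
  then show ?thesis
    by (simp add: log_speed_eq r_def has_real_derivative_iff_has_vector_derivative)
qed

lemma B_derivative: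
  assumes z: "z \<in> S"
  shows "((\<lambda>t. B (z + d * of_real t)) has_vector_derivative
      d * C z + cnj d * of_real (A z) - 2 * B z * of_real (Re (d * B z))) (at 0)"
proof -
  have H: "((\<lambda>t. hermitian (\<phi>2 (z + d * of_real t)) (\<phi>1 (z + d * of_real t))) has_vector_derivative
      d * hermitian (\<phi>3 z) (\<phi>1 z) + cnj d * hermitian (\<phi>2 z) (\<phi>2 z)) (at 0)"
    using hermitian_has_vector_derivative[OF hol2 hol1 open_S _ line_has_vector_derivative, of z d 0] z
    by simp
  have "((\<lambda>t. inverse (E (z + d * of_real t))) has_real_derivative
      - (inverse (E z) * (2 * E z * Re (d * B z)) * inverse (E z))) (at 0)"
    using E_derivative[OF z, of d] E_pos[OF z] 
    by (intro DERIV_inverse'[THEN DERIV_cong]) (auto simp: has_real_derivative_iff_has_vector_derivative)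
  from has_vector_derivative_scaleR[OF this H]
  have "((\<lambda>t. B (z + d * of_real t)) has_vector_derivative
      inverse (E z) *\<^sub>R (d * hermitian (\<phi>3 z) (\<phi>1 z) + cnj d * hermitian (\<phi>2 z) (\<phi>2 z))
      - (inverse (E z) * (2 * E z * Re (d * B z)) * inverse (E z)) *\<^sub>R hermitian (\<phi>2 z) (\<phi>1 z)) (at 0)"
    by (simp add: B_def[of "z + _"] scaleR_conv_of_real divide_inverse mult.commute)
  also have "inverse (E z) *\<^sub>R (d * hermitian (\<phi>3 z) (\<phi>1 z) + cnj d * hermitian (\<phi>2 z) (\<phi>2 z))
      - (inverse (E z) * (2 * E z * Re (d * B z)) * inverse (E z)) *\<^sub>R hermitian (\<phi>2 z) (\<phi>1 z)
      = d * C z + cnj d * of_real (A z) - 2 * B z * of_real (Re (d * B z))"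
    using E_pos[OF z]
    by (simp add: hermitian_self hermitian_\<phi>2_\<phi>1[OF z] hermitian_\<phi>3_\<phi>1[OF z] inner_\<phi>2_\<phi>2[OF z]
        scaleR_conv_of_real field_simps)
  finally show ?thesis .
qed

lemma wirtinger_log_speed:
  assumes z: "z \<in> S"
  shows "wirtinger (\<lambda>w. of_real (log_speed \<phi> w)) z = B z / 2"
proof -
  have "((\<lambda>t. complex_of_real (log_speed \<phi> (z + d * of_real t))) has_vector_derivative
      of_real (Re (d * B z))) (at 0)" for d
    using has_vector_derivative_of_real[OF log_speed_derivative[OF z,
        folded has_real_derivative_iff_has_vector_derivative]] .
  from vector_derivative_at[OF this[of 1]] vector_derivative_at[OF this[of \<i>]]
  have "partial_x (\<lambda>w. complex_of_real (log_speed \<phi> w)) z = of_real (Re (B z))"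
    "partial_y (\<lambda>w. complex_of_real (log_speed \<phi> w)) z = of_real (- Im (B z))"
    by (simp_all add: partial_x_def partial_y_def)
  then show ?thesis
    by (simp add: wirtinger_def complex_eq_iff)
qed

lemma wirtinger2_log_speed:
  assumes z: "z \<in> S"
  shows "wirtinger (wirtinger (\<lambda>w. of_real (log_speed \<phi> w))) z = (C z - (B z)\<^sup>2) / 2"
proof -
  let ?W = "wirtinger (\<lambda>w. of_real (log_speed \<phi> w))"
  have "((\<lambda>t. ?W (z + d * of_real t)) has_vector_derivative
      (d * C z + cnj d * of_real (A z) - 2 * B z * of_real (Re (d * B z))) / 2) (at 0)" for d
    by (rule has_vector_derivative_cong_on_line[OF _ open_S z wirtinger_log_speed])
      (auto intro!: derivative_eq_intros B_derivative[OF z])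
  from vector_derivative_at[OF this[of 1]] vector_derivative_at[OF this[of \<i>]]
  have "partial_x ?W z = (C z + of_real (A z) - 2 * B z * of_real (Re (B z))) / 2"
    "partial_y ?W z = (\<i> * C z - \<i> * of_real (A z) + 2 * B z * of_real (Im (B z))) / 2"
    by (simp_all add: partial_x_def partial_y_def)
  then show ?thesis
    by (simp add: wirtinger_def complex_eq_iff power2_eq_square field_simps)
qed

lemma laplacian_log_speed:
  assumes z: "z \<in> S"
  shows "laplacian (log_speed \<phi>) z = 2 * (A z - (cmod (B z))\<^sup>2)"
proof -
  have p: "partial_x (log_speed \<phi>) w = Re (1 * B w)" "partial_y (log_speed \<phi>) w = Re (\<i> * B w)"
    if "w \<in> S" for w
    using vector_derivative_at[OF log_speed_derivative[OF that, of 1]]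
      vector_derivative_at[OF log_speed_derivative[OF that, of \<i>]]
    by (simp_all add: partial_x_def partial_y_def)
  have q: "((\<lambda>t. Re (d * B (z + d * of_real t))) has_vector_derivative
      Re (d * (d * C z + cnj d * of_real (A z) - 2 * B z * of_real (Re (d * B z))))) (at 0)" for d
    by (intro has_vector_derivative_Re has_vector_derivative_mult_right B_derivative z)
  have "partial_x (partial_x (log_speed \<phi>)) z = Re (C z + of_real (A z) - 2 * B z * of_real (Re (B z)))"
    using vector_derivative_at[OF has_vector_derivative_cong_on_line[OF q[of 1] open_S z p(1)]]
    by (simp add: partial_x_def)
  moreover have "partial_y (partial_y (log_speed \<phi>)) z =
      Re (\<i> * (\<i> * C z - \<i> * of_real (A z) + 2 * B z * of_real (Im (B z))))"
    using vector_derivative_at[OF has_vector_derivative_cong_on_line[OF q[of \<i>] open_S z p(2)]]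
    by (simp add: partial_y_def)
  ultimately show ?thesis
    by (simp add: laplacian_def cmod_power2) (simp add: power2_eq_square algebra_simps)
qed

lemma curve_schwarzian_eq:
  assumes z: "z \<in> S"
  shows "curve_schwarzian \<phi> z = C z - 3 / 2 * (B z)\<^sup>2"
  unfolding curve_schwarzian_def Let_def wirtinger_log_speed[OF z] wirtinger2_log_speed[OF z]
  by (simp add: field_simps power2_eq_square)

lemma curvature_term_eq:
  assumes z: "z \<in> S"
  shows "(norm (\<phi>1 z))\<^sup>2 * \<bar>gauss_curvature \<phi> z\<bar> = 2 * \<bar>A z - (cmod (B z))\<^sup>2\<bar>"
proof -
  have "exp (- 2 * log_speed \<phi> z) = inverse (E z)"
    using E_pos[OF z] by (simp add: log_speed_eq exp_minus)
  moreover have "(norm (\<phi>1 z))\<^sup>2 = E z"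
    by (simp add: E_def power2_norm_eq_inner)
  ultimately show ?thesis
    using E_pos[OF z]
    by (simp add: gauss_curvature_def laplacian_log_speed[OF z] abs_mult del: right_diff_distrib_numeral)
qed

text \<open>Along a line in the direction \<open>\<zeta>\<close> the real Schwarzian equals
  \<open>Re (\<zeta>\<^sup>2 S\<phi>) + 3/2 (A - \<bar>B\<bar>\<^sup>2)\<close>, and the last term is the curvature term of the hypothesis. So the
  left side of the hypothesis on \<open>\<phi>\<close> dominates the real Schwarzian of \<open>\<phi>\<close> along every line.\<close>

lemma real_schwarzian_le:
  assumes z: "z \<in> S" and \<zeta>: "cmod \<zeta> = 1"
  shows "real_schwarzian (\<zeta> *s \<phi>1 z) (\<zeta>\<^sup>2 *s \<phi>2 z) (\<zeta> ^ 3 *s \<phi>3 z)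
    \<le> cmod (curve_schwarzian \<phi> z) + 3 / 4 * (norm (\<phi>1 z))\<^sup>2 * \<bar>gauss_curvature \<phi> z\<bar>"
proof -
  have unit: "\<zeta> * cnj \<zeta> = 1"
    using \<zeta> by (simp add: complex_norm_square[symmetric])
  have E: "E z > 0" by (rule E_pos[OF z])
  note h = hermitian_\<phi>2_\<phi>1[OF z] hermitian_\<phi>3_\<phi>1[OF z] inner_\<phi>2_\<phi>2[OF z]
  have i11: "(\<zeta> *s \<phi>1 z) \<bullet> (\<zeta> *s \<phi>1 z) = E z"
    by (simp add: inner_smult unit hermitian_self E_def)
  have k: "\<zeta>\<^sup>2 * cnj \<zeta> = \<zeta>" "\<zeta> ^ 3 * cnj \<zeta> = \<zeta>\<^sup>2" "\<zeta>\<^sup>2 * cnj (\<zeta>\<^sup>2) = 1"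
    unfolding complex_cnj_power using unit by algebra+
  have i12: "(\<zeta> *s \<phi>1 z) \<bullet> (\<zeta>\<^sup>2 *s \<phi>2 z) = E z * Re (\<zeta> * B z)"
    by (subst inner_commute, unfold inner_smult k h) (simp add: algebra_simps)
  have i13: "(\<zeta> *s \<phi>1 z) \<bullet> (\<zeta> ^ 3 *s \<phi>3 z) = E z * Re (\<zeta>\<^sup>2 * C z)"
    by (subst inner_commute, unfold inner_smult k h) (simp add: algebra_simps)
  have i22: "(\<zeta>\<^sup>2 *s \<phi>2 z) \<bullet> (\<zeta>\<^sup>2 *s \<phi>2 z) = E z * A z"
    unfolding inner_smult k by (simp add: Re_hermitian h)
  have "real_schwarzian (\<zeta> *s \<phi>1 z) (\<zeta>\<^sup>2 *s \<phi>2 z) (\<zeta> ^ 3 *s \<phi>3 z)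
      = Re (\<zeta>\<^sup>2 * C z) - 3 * (Re (\<zeta> * B z))\<^sup>2 + 3 / 2 * A z"
    unfolding real_schwarzian_def i11 i12 i13 i22 using E by (simp add: power_mult_distrib)
  also have "\<dots> = Re (\<zeta>\<^sup>2 * curve_schwarzian \<phi> z) + 3 / 2 * (A z - (cmod (\<zeta> * B z))\<^sup>2)"
  proof -
    define b where "b = \<zeta> * B z"
    have "\<zeta>\<^sup>2 * curve_schwarzian \<phi> z = \<zeta>\<^sup>2 * C z - 3 / 2 * b\<^sup>2"
      by (simp add: curve_schwarzian_eq[OF z] b_def power_mult_distrib right_diff_distrib mult.left_commute)
    then have "Re (\<zeta>\<^sup>2 * curve_schwarzian \<phi> z) = Re (\<zeta>\<^sup>2 * C z) - Re (3 / 2 * b\<^sup>2)"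
      by (simp only: minus_complex.sel)
    also have "Re (3 / 2 * b\<^sup>2) = 3 / 2 * ((Re b)\<^sup>2 - (Im b)\<^sup>2)"
      by (simp add: Re_power2)
    finally show ?thesis
      unfolding b_def[symmetric] cmod_power2 by argo
  qed
  also have "\<dots> \<le> cmod (curve_schwarzian \<phi> z) + 3 / 2 * \<bar>A z - (cmod (B z))\<^sup>2\<bar>"
  proof -
    have "Re (\<zeta>\<^sup>2 * curve_schwarzian \<phi> z) \<le> cmod (curve_schwarzian \<phi> z)"
      using complex_Re_le_cmod[of "\<zeta>\<^sup>2 * curve_schwarzian \<phi> z"] \<zeta>
      by (simp only: norm_mult norm_power) simp
    moreover have eq: "cmod (\<zeta> * B z) = cmod (B z)"
      using \<zeta> by (simp add: norm_mult)
    ultimately show ?thesis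
      unfolding eq by (intro add_mono mult_left_mono) auto
  qed
  finally show ?thesis
    using curvature_term_eq[OF z] by simp
qed

end

section \<open>The sphere and uniformly continuous extensions\<close>

text \<open>Stereographic projection is conformal with factor \<open>2 / (1 + (norm x)\<^sup>2)\<close>.\<close>

lemma to_sphere_speed:
  fixes f :: "real \<Rightarrow> 'a::real_inner"
  assumes df: "(f has_vector_derivative f') (at t)"
  obtains D where "((\<lambda>t. to_sphere (Finite_Point (f t))) has_vector_derivative D) (at t)"
    "norm D = 2 * norm f' / (1 + (norm (f t))\<^sup>2)"
proof -
  define m where "m t = f t \<bullet> f t + 1" for t
  define k where "k = f t \<bullet> f'"
  define D where "D = ((2 / m t) *\<^sub>R f' - (4 * k / (m t)\<^sup>2) *\<^sub>R f t, 4 * k / (m t)\<^sup>2)"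
  have m: "m t > 0" by (simp add: m_def add_nonneg_pos)
  have dm: "(m has_real_derivative 2 * k) (at t)"
    unfolding m_def k_def using DERIV_inner_curves[OF df df]
    by (auto intro!: derivative_eq_intros simp: inner_commute)
  have "((\<lambda>t. 2 / m t) has_real_derivative - (4 * k / (m t)\<^sup>2)) (at t)"
    using m by (auto intro!: derivative_eq_intros dm simp: power2_eq_square)
  from has_vector_derivative_scaleR[OF this df]
  have d1: "((\<lambda>t. (2 / m t) *\<^sub>R f t) has_vector_derivative (2 / m t) *\<^sub>R f' - (4 * k / (m t)\<^sup>2) *\<^sub>R f t) (at t)"
    by simp
  have "((\<lambda>t. (m t - 2) / m t) has_real_derivative 4 * k / (m t)\<^sup>2) (at t)"
    using m by (auto intro!: derivative_eq_intros dm simp: power2_eq_square field_simps)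
  then have d2: "((\<lambda>t. (m t - 2) / m t) has_vector_derivative 4 * k / (m t)\<^sup>2) (at t)"
    by (simp add: has_real_derivative_iff_has_vector_derivative)
  have ts: "to_sphere (Finite_Point (f t)) = ((2 / m t) *\<^sub>R f t, (m t - 2) / m t)" for t
    by (simp add: m_def power2_norm_eq_inner)
  have "((\<lambda>t. to_sphere (Finite_Point (f t))) has_vector_derivative D) (at t)"
    unfolding ts D_def by (rule has_vector_derivative_Pair[OF d1 d2])
  moreover have "norm D = 2 * norm f' / (1 + (norm (f t))\<^sup>2)"
  proof -
    have ff: "f t \<bullet> f t = m t - 1" and fk: "f' \<bullet> f t = k" "f t \<bullet> f' = k"
      by (simp_all add: m_def k_def inner_commute)
    have "(\<alpha> *\<^sub>R f' - \<beta> *\<^sub>R f t, \<beta>) \<bullet> (\<alpha> *\<^sub>R f' - \<beta> *\<^sub>R f t, \<beta>)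
        = \<alpha>\<^sup>2 * (f' \<bullet> f') - 2 * \<alpha> * \<beta> * k + \<beta>\<^sup>2 * (f t \<bullet> f t) + \<beta>\<^sup>2" for \<alpha> \<beta>
      by (simp add: fk inner_Pair inner_diff_left inner_diff_right power2_eq_square algebra_simps)
    then have "D \<bullet> D = (2 / m t)\<^sup>2 * (f' \<bullet> f') - 2 * (2 / m t) * (4 * k / (m t)\<^sup>2) * k
        + (4 * k / (m t)\<^sup>2)\<^sup>2 * (m t - 1) + (4 * k / (m t)\<^sup>2)\<^sup>2"
      unfolding D_def ff .
    also have "\<dots> = (2 / m t)\<^sup>2 * (f' \<bullet> f')"
      using m by (simp add: field_simps power2_eq_square)
    also have "\<dots> = (2 * norm f' / m t)\<^sup>2"
      by (simp add: power2_norm_eq_inner[symmetric] power_mult_distrib power_divide)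
    finally have "norm D = 2 * norm f' / m t"
      using m by (simp add: norm_eq_sqrt_inner[of D] del: real_sqrt_pow2_iff)
    then show ?thesis by (simp add: m_def power2_norm_eq_inner add.commute)
  qed
  ultimately show ?thesis by (rule that)
qed

lemma to_sphere_surj:
  fixes q :: "'a::real_inner \<times> real"
  assumes "norm q = 1"
  obtains x where "to_sphere x = q"
proof (cases q)
  case (Pair v s)
  have vs: "(norm v)\<^sup>2 + s\<^sup>2 = 1"
    using assms by (simp add: Pair norm_Pair)
  show ?thesis
  proof (cases "s = 1")
    case True
    then have "to_sphere Infinity_Point = q"
      using vs by (simp add: Pair)
    then show ?thesis by (rule that)
  next
    case False
    define x where "x = (1 / (1 - s)) *\<^sub>R v"
    have "(norm x)\<^sup>2 + 1 = ((norm v)\<^sup>2 + (1 - s)\<^sup>2) / (1 - s)\<^sup>2"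
      using False by (simp add: x_def power_divide add_divide_distrib)
    also have "(norm v)\<^sup>2 + (1 - s)\<^sup>2 = 2 * (1 - s)"
      using vs by (simp add: power2_eq_square algebra_simps)
    also have "2 * t / t\<^sup>2 = 2 / t" for t :: real
      by (cases "t = 0") (simp_all add: power2_eq_square)
    finally have n: "(norm x)\<^sup>2 + 1 = 2 / (1 - s)" .
    have c: "2 / ((norm x)\<^sup>2 + 1) = 1 - s"
      unfolding n by simp
    have "((norm x)\<^sup>2 - 1) / ((norm x)\<^sup>2 + 1) = 1 - 2 / ((norm x)\<^sup>2 + 1)"
      using add_nonneg_pos[OF zero_le_power2[of "norm x"] zero_less_one] by (simp add: field_simps)
    also have "\<dots> = s"
      unfolding c by simp
    finally have "to_sphere (Finite_Point x) = q"
      unfolding to_sphere.simps c using False by (simp add: x_def Pair)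
    then show ?thesis by (rule that)
  qed
qed

text \<open>On the unit sphere, the great-circle distance is uniformly small where the chordal distance
  is. Thus continuity questions in \<open>one_point\<close> reduce to the ambient Euclidean space, which is
  complete.\<close>

lemma arccos_inner_small:
  fixes e :: real
  assumes "e > 0"
  obtains d where "d > 0"
    "\<And>a b :: 'a::real_inner. \<lbrakk>norm a = 1; norm b = 1; dist a b < d\<rbrakk> \<Longrightarrow> arccos (a \<bullet> b) < e"
proof -
  have "continuous_on {-1..1} arccos"
    by (rule continuous_on_arccos')
  then obtain d0 where d0: "d0 > 0" "\<And>t. \<lbrakk>-1 \<le> t; t \<le> 1; dist t 1 < d0\<rbrakk> \<Longrightarrow> dist (arccos t) (arccos 1) < e"
    using assms unfolding continuous_on_iff
    by (elim ballE[of _ _ 1] allE[of _ e]) (auto simp del: arccos_1)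
  show ?thesis
  proof (rule that[of "sqrt d0"])
    fix a b :: 'a assume ab: "norm a = 1" "norm b = 1" "dist a b < sqrt d0"
    have "(dist a b)\<^sup>2 = 2 - 2 * (a \<bullet> b)"
      using ab(1,2) unfolding dist_norm power2_norm_eq_inner
      by (simp add: inner_diff_left inner_diff_right inner_commute norm_eq_1)
    moreover have "(dist a b)\<^sup>2 < d0"
      using ab(3) d0(1) real_less_rsqrt[of "dist a b" d0]
      by (metis abs_of_nonneg real_sqrt_abs real_sqrt_less_iff zero_le_dist)
    ultimately have "dist (a \<bullet> b) 1 < d0"
      using abs_inner_unit_le_1[OF ab(1,2)] by (simp add: dist_real_def)
    then show "arccos (a \<bullet> b) < e"
      using d0(2)[of "a \<bullet> b"] abs_inner_unit_le_1[OF ab(1,2)] by (simp add: dist_real_def)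
  qed (use d0 in simp)
qed

lemma extension_to_one_point:
  fixes \<phi> :: "'b::metric_space \<Rightarrow> 'a::euclidean_space"
  assumes uc: "uniformly_continuous_on S (\<lambda>z. to_sphere (Finite_Point (\<phi> z)))"
  obtains \<Phi> where "\<And>z. z \<in> S \<Longrightarrow> \<Phi> z = Finite_Point (\<phi> z)" "uniformly_continuous_on (closure S) \<Phi>"
proof -
  obtain g where g: "uniformly_continuous_on (closure S) g"
    and gS: "\<And>z. z \<in> S \<Longrightarrow> to_sphere (Finite_Point (\<phi> z)) = g z"
    using uniformly_continuous_on_extension_on_closure[OF uc] by metis
  have norm_g: "norm (g z) = 1" if "z \<in> closure S" for z
  proof -
    have "closed (sphere (0 :: 'a \<times> real) 1)"
      by simp
    moreover have "g ` S \<subseteq> sphere 0 1"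
      using gS norm_to_sphere by (metis image_subsetI mem_sphere_0)
    ultimately have "g ` closure S \<subseteq> sphere 0 1"
      by (intro image_closure_subset uniformly_continuous_imp_continuous g)
    then show ?thesis using that by auto
  qed
  define \<Phi> where "\<Phi> z = inv to_sphere (g z)" for z
  have \<Phi>: "to_sphere (\<Phi> z) = g z" if z: "z \<in> closure S" for z
  proof -
    obtain x where "to_sphere x = g z"
      by (rule to_sphere_surj[OF norm_g[OF z]])
    then show ?thesis
      unfolding \<Phi>_def by (metis f_inv_into_f rangeI)
  qed
  show ?thesis
  proof (rule that)
    show "\<Phi> z = Finite_Point (\<phi> z)" if "z \<in> S" for z
    proof -
      have "to_sphere (\<Phi> z) = to_sphere (Finite_Point (\<phi> z))"
        unfolding gS[OF that] using that closure_subset by (intro \<Phi>) auto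
      then show ?thesis by (rule injD[OF inj_to_sphere])
    qed
    show "uniformly_continuous_on (closure S) \<Phi>"
      unfolding uniformly_continuous_on_def
    proof (intro allI impI)
      fix e :: real assume "e > 0"
      then obtain d where d: "d > 0"
        "\<And>a b :: 'a \<times> real. \<lbrakk>norm a = 1; norm b = 1; dist a b < d\<rbrakk> \<Longrightarrow> arccos (a \<bullet> b) < e"
        using arccos_inner_small by metis
      obtain d' where "d' > 0"
        "\<And>x y. \<lbrakk>x \<in> closure S; y \<in> closure S; dist y x < d'\<rbrakk> \<Longrightarrow> dist (g y) (g x) < d"
        using g d(1) unfolding uniformly_continuous_on_def by metis
      then show "\<exists>d>0. \<forall>x\<in>closure S. \<forall>x'\<in>closure S. dist x' x < d \<longrightarrow> dist (\<Phi> x') (\<Phi> x) < e"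
        unfolding dist_one_point_def by (intro exI[of _ d'] conjI ballI impI) (simp_all only: \<Phi> norm_g d(2))
    qed
  qed
qed

text \<open>The points \<open>z\<close> range over a compact set that may be larger than the domain of \<open>T\<close>: at
  boundary points this is a Cauchy criterion, which needs no candidate for the limit, and a Lebesgue
  number makes the local smallness uniform.\<close>

lemma uniformly_continuous_on_if_locally_small_oscillation:
  fixes T :: "'a::metric_space \<Rightarrow> 'b::metric_space"
  assumes "compact K" "S \<subseteq> K"
    and osc: "\<And>z e. \<lbrakk>z \<in> K; e > 0\<rbrakk> \<Longrightarrow> \<exists>q. \<forall>\<^sub>F w in nhds z. w \<in> S \<longrightarrow> dist (T w) q < e"
  shows "uniformly_continuous_on S T"
  unfolding uniformly_continuous_on_def
proof (intro allI impI)
  fix e :: real assume e: "e > 0"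
  define \<G> where "\<G> = {G. open G \<and> (\<exists>q. \<forall>w\<in>G. w \<in> S \<longrightarrow> dist (T w) q < e / 2)}"
  have "K \<subseteq> \<Union>\<G>"
  proof
    fix z assume "z \<in> K"
    from osc[OF this, of "e / 2"] e obtain q where "\<forall>\<^sub>F w in nhds z. w \<in> S \<longrightarrow> dist (T w) q < e / 2"
      by auto
    then show "z \<in> \<Union>\<G>"
      unfolding eventually_nhds \<G>_def by blast
  qed
  then obtain d where d: "d > 0" "\<And>x. x \<in> K \<Longrightarrow> \<exists>G\<in>\<G>. ball x d \<subseteq> G"
    using Heine_Borel_lemma[OF \<open>compact K\<close>, of \<G>] unfolding \<G>_def by blast
  have "dist (T y) (T x) < e" if xy: "x \<in> S" "y \<in> S" "dist y x < d" for x y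
  proof -
    obtain G where G: "G \<in> \<G>" "ball x d \<subseteq> G"
      using d(2) xy(1) assms(2) by blast
    obtain q where q: "\<And>w. \<lbrakk>w \<in> G; w \<in> S\<rbrakk> \<Longrightarrow> dist (T w) q < e / 2"
      using G(1) unfolding \<G>_def by blast
    have "x \<in> G" "y \<in> G"
      using G(2) xy d(1) by (auto simp: dist_commute)
    then show ?thesis
      using dist_triangle_half_l[OF q[of y] q[of x]] xy by simp
  qed
  then show "\<exists>d>0. \<forall>x\<in>S. \<forall>x'\<in>S. dist x' x < d \<longrightarrow> dist (T x') (T x) < e"
    using d(1) by (intro exI[of _ d]) auto
qed

section \<open>Radial boundary behaviour\<close>

lemma smult_has_vector_derivative:
  fixes g :: "real \<Rightarrow> complex ^ 'n"
  assumes "(g has_vector_derivative g') (at t)"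
  shows "((\<lambda>t. c *s g t) has_vector_derivative c *s g') (at t)"
proof (rule has_vector_derivative_componentwise)
  fix i
  have "((\<lambda>t. g t $ i) has_vector_derivative g' $ i) (at t)"
    by (rule bounded_linear.has_vector_derivative[OF bounded_linear_vec_nth assms])
  then show "((\<lambda>t. (c *s g t) $ i) has_vector_derivative (c *s g') $ i) (at t)"
    by (simp add: has_vector_derivative_mult_right)
qed

lemma norm_smult:
  fixes a :: "complex ^ 'n"
  shows "norm (c *s a) = cmod c * norm a"
proof -
  have "(norm (c *s a))\<^sup>2 = (cmod c * norm a)\<^sup>2"
    unfolding power2_norm_eq_inner inner_smult hermitian_self
    by (simp add: complex_norm_square[symmetric] power_mult_distrib power2_norm_eq_inner)
  then show ?thesis
    by (simp add: power2_eq_iff_nonneg)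
qed

text \<open>The Euclidean metric pulled back under inversion at \<open>a\<close> has density \<open>1 / (norm (x - a))\<^sup>2\<close>. It
  controls the spherical density up to a constant, because inversion extends smoothly to the sphere,
  and it still does so when its pole is truncated by \<open>\<eta>\<close>.\<close>

lemma euclidean_le_spherical_density:
  fixes x a :: "'a::real_inner"
  assumes "\<eta> > 0"
  shows "1 / (1 + (norm x)\<^sup>2) \<le> (2 + 2 * (norm a)\<^sup>2 + \<eta>\<^sup>2) / ((norm (x - a))\<^sup>2 + \<eta>\<^sup>2)"
proof -
  have "(norm (x - a))\<^sup>2 \<le> (norm x + norm a)\<^sup>2"
    by (intro power_mono norm_triangle_ineq4) auto
  also have "\<dots> \<le> 2 * (norm x)\<^sup>2 + 2 * (norm a)\<^sup>2"
    using zero_le_power2[of "norm x - norm a"] by (simp add: power2_eq_square algebra_simps)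
  finally have "(norm (x - a))\<^sup>2 + \<eta>\<^sup>2 \<le> (2 + 2 * (norm a)\<^sup>2 + \<eta>\<^sup>2) * (1 + (norm x)\<^sup>2)"
    by (simp add: algebra_simps) 
      (smt (verit, best) mult_nonneg_nonneg zero_le_power2)
  moreover have "(norm (x - a))\<^sup>2 + \<eta>\<^sup>2 > 0" "1 + (norm x)\<^sup>2 > 0"
    using assms by (auto simp: add_nonneg_pos add_pos_nonneg)
  ultimately show ?thesis
    by (simp add: divide_simps)
qed

text \<open>The left side is the initial slope required by \<open>sturm_comparison_of_curve\<close>. The
  centre of inversion \<open>\<phi> z - X\<close> lies on the tangent line in the direction \<open>\<zeta>0\<close>, slightly behind \<open>\<phi> z\<close>:
  moving ahead increases the distance from it at a relative rate \<open>1 / (4 \<epsilon>)\<close> or more, for all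
  directions \<open>\<zeta>\<close> within 60 degrees of \<open>\<zeta>0\<close>, and this beats the term with \<open>\<phi>2\<close>, of size at most
  \<open>\<beta> / 2\<close>, when \<open>\<epsilon>\<close> is as chosen.\<close>

lemma (in immersed_curve) slope_at_center:
  assumes z: "z \<in> S" and \<zeta>: "cmod \<zeta> = 1" "cmod \<zeta>0 = 1" "Re (\<zeta>0 * cnj \<zeta>) \<ge> 1 / 2"
  defines "\<beta> \<equiv> norm (\<phi>2 z) / norm (\<phi>1 z)"
  defines "\<epsilon> \<equiv> 1 / (4 * (\<beta> + 1))"
  defines "X \<equiv> \<epsilon> *\<^sub>R (\<zeta>0 *s \<phi>1 z)"
  shows "X \<bullet> (\<zeta> *s \<phi>1 z) / ((norm X)\<^sup>2 + (\<epsilon> * norm (\<phi>1 z))\<^sup>2)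
      - (\<zeta> *s \<phi>1 z) \<bullet> (\<zeta>\<^sup>2 *s \<phi>2 z) / (2 * (norm (\<zeta> *s \<phi>1 z))\<^sup>2) \<ge> 1"
proof -
  have n1: "norm (\<phi>1 z) > 0"
    using immersed[OF z] by simp
  have \<beta>: "\<beta> \<ge> 0" by (simp add: \<beta>_def)
  then have \<epsilon>: "\<epsilon> > 0" by (simp add: \<epsilon>_def)
  have "X \<bullet> (\<zeta> *s \<phi>1 z) = \<epsilon> * (norm (\<phi>1 z))\<^sup>2 * Re (\<zeta>0 * cnj \<zeta>)"
    unfolding X_def inner_scaleR_left inner_smult hermitian_self by (simp add: power2_norm_eq_inner)
  moreover have "(norm X)\<^sup>2 + (\<epsilon> * norm (\<phi>1 z))\<^sup>2 = 2 * \<epsilon>\<^sup>2 * (norm (\<phi>1 z))\<^sup>2"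
    using \<zeta> \<epsilon> by (simp add: X_def norm_smult power_mult_distrib)
  ultimately have "X \<bullet> (\<zeta> *s \<phi>1 z) / ((norm X)\<^sup>2 + (\<epsilon> * norm (\<phi>1 z))\<^sup>2) = Re (\<zeta>0 * cnj \<zeta>) / (2 * \<epsilon>)"
    using n1 \<epsilon> by (simp only:) (simp add: power2_eq_square)
  also have "\<dots> \<ge> (1 / 2) / (2 * \<epsilon>)"
    using \<zeta>(3) \<epsilon> by (intro divide_right_mono) auto
  also have "(1 / 2) / (2 * \<epsilon>) = \<beta> + 1"
    using \<beta> by (simp add: \<epsilon>_def)
  finally have 1: "X \<bullet> (\<zeta> *s \<phi>1 z) / ((norm X)\<^sup>2 + (\<epsilon> * norm (\<phi>1 z))\<^sup>2) \<ge> \<beta> + 1" .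
  have "(\<zeta> *s \<phi>1 z) \<bullet> (\<zeta>\<^sup>2 *s \<phi>2 z) \<le> norm (\<phi>1 z) * norm (\<phi>2 z)"
    using norm_cauchy_schwarz[of "\<zeta> *s \<phi>1 z" "\<zeta>\<^sup>2 *s \<phi>2 z"] \<zeta> by (simp add: norm_smult norm_power)
  then have "(\<zeta> *s \<phi>1 z) \<bullet> (\<zeta>\<^sup>2 *s \<phi>2 z) / (2 * (norm (\<zeta> *s \<phi>1 z))\<^sup>2)
      \<le> norm (\<phi>1 z) * norm (\<phi>2 z) / (2 * (norm (\<phi>1 z))\<^sup>2)"
    using \<zeta> by (simp add: norm_smult divide_right_mono)
  also have "\<dots> = \<beta> / 2"
    using n1 by (simp add: \<beta>_def power2_eq_square)
  finally show ?thesis using 1 \<beta> by linarith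
qed

text \<open>One modulus \<open>G\<close> serves all radii in a sector around \<open>\<zeta>0\<close>, because \<open>U\<close>, \<open>F\<close>, the centre of
  inversion and the initial value \<open>w0\<close> are the same for all of them. The bound \<open>G \<le> 0\<close> makes the
  increments of \<open>G\<close> small near \<open>1\<close>, so the radial limits are attained uniformly in the sector.\<close>

lemma radial_modulus:
  fixes \<phi> :: "complex \<Rightarrow> complex ^ 'n"
  assumes p: "nehari_function p"
    and hol: "curve_holomorphic_on \<phi> (ball 0 1)"
    and imm: "\<And>z. z \<in> ball 0 1 \<Longrightarrow> curve_deriv \<phi> z \<noteq> 0"
    and bound: "\<And>z. z \<in> ball 0 1 \<Longrightarrow>
           cmod (curve_schwarzian \<phi> z)
             + 3 / 4 * (norm (curve_deriv \<phi> z))\<^sup>2 * \<bar>gauss_curvature \<phi> z\<bar>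
           \<le> 2 * p (cmod z)"
    and \<zeta>0: "cmod \<zeta>0 = 1"
  obtains G :: "real \<Rightarrow> real" where "\<And>x. x \<in> {0..<1} \<Longrightarrow> G x \<le> 0"
    "\<And>\<zeta> r s. \<lbrakk>cmod \<zeta> = 1; Re (\<zeta>0 * cnj \<zeta>) \<ge> 1 / 2; 0 \<le> r; r \<le> s; s < 1\<rbrakk> \<Longrightarrow>
       dist (to_sphere (Finite_Point (\<phi> (of_real s * \<zeta>)))) (to_sphere (Finite_Point (\<phi> (of_real r * \<zeta>))))
       \<le> G s - G r"
proof -
  interpret immersed_curve \<phi> "ball 0 1"
    using hol imm by unfold_locales auto
  obtain U V where U0: "U 0 = 1" "V 0 = 0"
    and dU: "\<And>x. x \<in> {-1<..<1} \<Longrightarrow> (U has_real_derivative V x) (at x)"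
    and dV: "\<And>x. x \<in> {-1<..<1} \<Longrightarrow> (V has_real_derivative - p x * U x) (at x)"
    and U: "\<And>x. x \<in> {-1<..<1} \<Longrightarrow> U x > 0"
    using nehari_positive_solution[OF p] by metis
  have "continuous_on {-1<..<1} U"
    using dU by (intro DERIV_continuous_on[of _ _ V]) (auto intro: has_field_derivative_at_within)
  then have "continuous_on {-1<..<1} (\<lambda>x. 1 / (U x)\<^sup>2)"
    using U by (intro continuous_intros) fastforce+
  then obtain F where F0: "F 0 = 0"
    and dF: "\<And>x. x \<in> {-1<..<1} \<Longrightarrow> (F has_real_derivative 1 / (U x)\<^sup>2) (at x)"
    using antiderivative_vanishing_at_0 by metis
  have F: "F x \<ge> 0" if x: "x \<in> {0..<1}" for x
  proof -
    have "F 0 \<le> F x"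
    proof (rule DERIV_nonneg_imp_nondecreasing[where f = F])
      fix t assume "0 \<le> t" "t \<le> x"
      then show "\<exists>d. (F has_real_derivative d) (at t) \<and> d \<ge> 0"
        using dF[of t] x by (intro exI[of _ "1 / (U t)\<^sup>2"]) auto
    qed (use x in auto)
    then show ?thesis using F0 by simp
  qed
  define \<beta> where "\<beta> = norm (\<phi>2 0) / norm (\<phi>1 0)"
  define \<epsilon> where "\<epsilon> = 1 / (4 * (\<beta> + 1))"
  define X where "X = \<epsilon> *\<^sub>R (\<zeta>0 *s \<phi>1 0)"
  define a where "a = \<phi> 0 - X"
  define \<eta> where "\<eta> = \<epsilon> * norm (\<phi>1 0)"
  define K where "K = 2 + 2 * (norm a)\<^sup>2 + \<eta>\<^sup>2"
  define w0 where "w0 = sqrt (((norm X)\<^sup>2 + \<eta>\<^sup>2) / norm (\<phi>1 0))"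
  define G where "G x = - (2 * K / w0\<^sup>2) / (1 + F x)" for x
  have n1: "norm (\<phi>1 0) > 0"
    using imm[of 0] by simp
  have "\<beta> \<ge> 0" by (simp add: \<beta>_def)
  then have \<eta>: "\<eta> > 0" using n1 by (simp add: \<eta>_def \<epsilon>_def)
  then have w0: "w0 > 0"
    using n1 by (simp add: w0_def add_nonneg_pos)
  have K: "K > 0" by (simp add: K_def add_pos_nonneg)
  have dG: "(G has_real_derivative 2 * K * (1 / (U x * (w0 + w0 * F x))\<^sup>2)) (at x)" if x: "x \<in> {0..<1}" for x
  proof -
    have "U x \<noteq> 0" "1 + F x \<noteq> 0"
      using U[of x] F[OF x] x by auto
    moreover have "w0 + w0 * F x = w0 * (1 + F x)"
      by (simp add: distrib_left)
    ultimately show ?thesis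
      unfolding G_def using dF[of x] x w0
      by (auto intro!: derivative_eq_intros simp: power2_eq_square)
  qed
  show ?thesis
  proof (rule that[of G])
    show "G x \<le> 0" if "x \<in> {0..<1}" for x
      using F[OF that] K by (simp add: G_def)
    fix \<zeta> and r s :: real
    assume \<zeta>: "cmod \<zeta> = 1" "Re (\<zeta>0 * cnj \<zeta>) \<ge> 1 / 2" and rs: "0 \<le> r" "r \<le> s" "s < 1"
    have inb: "of_real x * \<zeta> \<in> ball 0 1" if "x \<in> {0..<1}" for x :: real
      using that \<zeta>(1) by (simp add: norm_mult)
    define f where "f x = \<phi> (of_real x * \<zeta>)" for x :: real
    define f1 where "f1 x = \<zeta> *s \<phi>1 (of_real x * \<zeta>)" for x :: real
    define f2 where "f2 x = \<zeta>\<^sup>2 *s \<phi>2 (of_real x * \<zeta>)" for x :: real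
    define f3 where "f3 x = \<zeta> ^ 3 *s \<phi>3 (of_real x * \<zeta>)" for x :: real
    have ray: "((\<lambda>x. of_real x * \<zeta>) has_vector_derivative \<zeta>) (at x)" for x
      by (auto intro!: derivative_eq_intros)
    have df: "(f has_vector_derivative f1 x) (at x)" if "x \<in> {0..<1}" for x
      unfolding f_def f1_def by (rule curve_has_vector_derivative[OF hol open_ball inb[OF that] ray])
    have df1: "(f1 has_vector_derivative f2 x) (at x)" if "x \<in> {0..<1}" for x
      using smult_has_vector_derivative[OF curve_has_vector_derivative[OF hol1 open_ball inb[OF that] ray], of \<zeta>]
      unfolding f1_def f2_def by (simp add: power2_eq_square)
    have df2: "(f2 has_vector_derivative f3 x) (at x)" if "x \<in> {0..<1}" for x
      using smult_has_vector_derivative[OF curve_has_vector_derivative[OF hol2 open_ball inb[OF that] ray], of "\<zeta>\<^sup>2"]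
      unfolding f2_def f3_def by (simp add: power2_eq_square power3_eq_cube mult.assoc)
    have f1: "norm (f1 x) = norm (\<phi>1 (of_real x * \<zeta>))" for x
      using \<zeta> by (simp add: f1_def norm_smult)
    have sturm: "norm (f1 x) / ((norm (f x - a))\<^sup>2 + \<eta>\<^sup>2) \<le> 1 / (U x * (w0 + w0 * F x))\<^sup>2"
      if x: "x \<in> {0..<1}" for x
    proof (rule sturm_comparison_of_curve[where f = f and ?f1.0 = f1 and ?f2.0 = f2 and ?f3.0 = f3
          and p = p and U = U and V = V and F = F])
      show "f1 y \<noteq> 0" if "y \<in> {0..<1}" for y
        using f1[of y] imm[OF inb[OF that]] by (metis norm_eq_zero)
      show "real_schwarzian (f1 y) (f2 y) (f3 y) \<le> 2 * p y" if "y \<in> {0..<1}" for y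
        using real_schwarzian_le[OF inb[OF that] \<zeta>(1)] bound[OF inb[OF that]] \<zeta>(1) that
        unfolding f1_def f2_def f3_def by (simp add: norm_mult)
      have f0: "f 0 - a = X"
        by (simp add: f_def a_def)
      show "(f 0 - a) \<bullet> f1 0 / ((norm (f 0 - a))\<^sup>2 + \<eta>\<^sup>2) - f1 0 \<bullet> f2 0 / (2 * (norm (f1 0))\<^sup>2) \<ge> 1"
        using slope_at_center[of 0 \<zeta> \<zeta>0] \<zeta> \<zeta>0 unfolding f0
        by (simp add: f1_def f2_def X_def \<eta>_def \<epsilon>_def \<beta>_def)
      show "w0 = sqrt (((norm (f 0 - a))\<^sup>2 + \<eta>\<^sup>2) / norm (f1 0))"
        unfolding f0 f1 by (simp add: w0_def)
    qed (use df df1 df2 U0 dU dV U F0 dF \<eta> x in auto)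
    have "\<exists>D. ((\<lambda>x. to_sphere (Finite_Point (f x))) has_vector_derivative D) (at x) \<and>
        norm D \<le> 2 * K * (1 / (U x * (w0 + w0 * F x))\<^sup>2)" if x: "x \<in> {0..<1}" for x
    proof -
      obtain D where D: "((\<lambda>x. to_sphere (Finite_Point (f x))) has_vector_derivative D) (at x)"
        "norm D = 2 * norm (f1 x) / (1 + (norm (f x))\<^sup>2)"
        using to_sphere_speed[OF df[OF x]] by metis
      have "norm D = 2 * norm (f1 x) * (1 / (1 + (norm (f x))\<^sup>2))"
        using D(2) by simp
      also have "\<dots> \<le> 2 * norm (f1 x) * (K / ((norm (f x - a))\<^sup>2 + \<eta>\<^sup>2))"
        unfolding K_def by (intro mult_left_mono euclidean_le_spherical_density \<eta>) auto
      also have "\<dots> = 2 * K * (norm (f1 x) / ((norm (f x - a))\<^sup>2 + \<eta>\<^sup>2))"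
        by simp
      also have "\<dots> \<le> 2 * K * (1 / (U x * (w0 + w0 * F x))\<^sup>2)"
        using sturm[OF x] K by (intro mult_left_mono) auto
      finally show ?thesis using D(1) by blast
    qed
    then obtain T' where T': "\<And>x. x \<in> {0..<1} \<Longrightarrow>
        ((\<lambda>x. to_sphere (Finite_Point (f x))) has_vector_derivative T' x) (at x)"
      "\<And>x. x \<in> {0..<1} \<Longrightarrow> norm (T' x) \<le> 2 * K * (1 / (U x * (w0 + w0 * F x))\<^sup>2)"
      by metis
    show "dist (to_sphere (Finite_Point (\<phi> (of_real s * \<zeta>)))) (to_sphere (Finite_Point (\<phi> (of_real r * \<zeta>))))
       \<le> G s - G r"
    proof (cases "r = s")
      case False
      have "norm (to_sphere (Finite_Point (f s)) - to_sphere (Finite_Point (f r))) \<le> G s - G r"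
      proof (rule differentiable_bound_general[where f' = T'
            and \<phi>' = "\<lambda>x. 2 * K * (1 / (U x * (w0 + w0 * F x))\<^sup>2)"])
        show "continuous_on {r..s} (\<lambda>x. to_sphere (Finite_Point (f x)))"
          using T'(1) rs
          by (intro continuous_on_vector_derivative[where f' = T']) (auto intro: has_vector_derivative_at_within)
        show "continuous_on {r..s} G"
          by (rule DERIV_continuous_on[OF has_field_derivative_at_within[OF dG]]) (use rs in auto)
      qed (use T' dG rs False in \<open>auto simp flip: has_real_derivative_iff_has_vector_derivative\<close>)
      then show ?thesis by (simp add: f_def dist_norm)
    qed simp
  qed
qed

lemma small_tail_if_bounded_above:
  fixes G :: "real \<Rightarrow> real"
  assumes "\<And>x. x \<in> {0..<1} \<Longrightarrow> G x \<le> b" "e > 0"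
  obtains r where "0 \<le> r" "r < 1" "\<And>s. \<lbrakk>r \<le> s; s < 1\<rbrakk> \<Longrightarrow> G s - G r < e"
proof -
  have ne: "G ` {0..<1} \<noteq> {}" and bdd: "bdd_above (G ` {0..<1})"
    using assms(1) by (auto intro!: bdd_aboveI2[where M = b])
  then obtain r where r: "r \<in> {0..<1}" "Sup (G ` {0..<1}) - e < G r"
    using less_cSup_iff[OF ne bdd, of "Sup (G ` {0..<1}) - e"] assms(2) by auto
  have "G s - G r < e" if "r \<le> s" "s < 1" for s
    using cSup_upper[OF _ bdd, of "G s"] that r by force
  then show ?thesis using r that by auto
qed

section \<open>The continuous extension to the closed disk\<close>

theorem theorem2:
  fixes p :: "real \<Rightarrow> real" and \<phi> :: "complex \<Rightarrow> complex ^ 'n"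
  assumes "nehari_function p"
    and "curve_holomorphic_on \<phi> (ball 0 1)"
    and "\<And>z. z \<in> ball 0 1 \<Longrightarrow> curve_deriv \<phi> z \<noteq> 0"
    and "\<And>z. z \<in> ball 0 1 \<Longrightarrow>
           cmod (curve_schwarzian \<phi> z)
             + 3 / 4 * (norm (curve_deriv \<phi> z))\<^sup>2 * \<bar>gauss_curvature \<phi> z\<bar>
           \<le> 2 * p (cmod z)"
  shows "\<exists>\<Phi> :: complex \<Rightarrow> (complex ^ 'n) one_point.
           (\<forall>z\<in>ball 0 1. \<Phi> z = Finite_Point (\<phi> z)) \<and>
           uniformly_continuous_on (cball 0 1) \<Phi>"
proof -
  define T where "T z = to_sphere (Finite_Point (\<phi> z))" for z
  have "continuous_on (ball 0 1) (\<lambda>z. \<phi> z $ i)" for i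
    using assms(2) by (simp add: curve_holomorphic_on_def holomorphic_on_imp_continuous_on)
  then have "continuous_on (ball 0 1) (\<lambda>z. \<chi> i. \<phi> z $ i)"
    by (intro continuous_on_vec_lambda)
  then have cont\<phi>: "continuous_on (ball 0 1) \<phi>"
    by simp
  have "(norm (\<phi> z))\<^sup>2 + 1 \<noteq> 0" for z
    using zero_le_power2[of "norm (\<phi> z)"] by linarith
  then have contT: "continuous_on (ball 0 1) T"
    unfolding T_def to_sphere.simps by (intro continuous_intros cont\<phi>) auto
  have isContT: "isCont T z" if "z \<in> ball 0 1" for z
    using contT that by (simp add: continuous_on_eq_continuous_at)
  have "uniformly_continuous_on (ball 0 1) T"
  proof (rule uniformly_continuous_on_if_locally_small_oscillation[of "cball 0 1"])
    fix z :: complex and e :: real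
    assume z: "z \<in> cball 0 1" and e: "e > 0"
    show "\<exists>q. \<forall>\<^sub>F w in nhds z. w \<in> ball 0 1 \<longrightarrow> dist (T w) q < e"
    proof (cases "z \<in> ball 0 1")
      case True
      have "(T \<longlongrightarrow> T z) (nhds z)"
        using isContT[OF True] by (simp add: tendsto_nhds_iff isCont_def)
      from tendstoD[OF this e] show ?thesis
        by (intro exI[of _ "T z"]) (auto elim: eventually_mono)
    next
      case False
      with z have nz: "cmod z = 1" by auto
      obtain G where G0: "\<And>x. x \<in> {0..<1} \<Longrightarrow> G x \<le> 0"
        and G: "\<And>\<zeta> r s. \<lbrakk>cmod \<zeta> = 1; Re (z * cnj \<zeta>) \<ge> 1 / 2; 0 \<le> r; r \<le> s; s < 1\<rbrakk> \<Longrightarrow>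
           dist (T (of_real s * \<zeta>)) (T (of_real r * \<zeta>)) \<le> G s - G r"
        using radial_modulus[OF assms nz] unfolding T_def by metis
      obtain r where r: "0 \<le> r" "r < 1" "\<And>s. \<lbrakk>r \<le> s; s < 1\<rbrakk> \<Longrightarrow> G s - G r < e / 2"
        using small_tail_if_bounded_above[of G 0 "e / 2"] G0 e by auto
      have sgnz: "sgn z = z"
        using nz by (simp add: sgn_eq)
      have z0: "z \<noteq> 0" using nz by auto
      have lim: "(sgn \<longlongrightarrow> z) (nhds z)"
        using tendsto_sgn[OF filterlim_ident z0] sgnz by simp
      have rz: "of_real r * z \<in> ball 0 1"
        using r nz by (simp add: norm_mult)
      \<comment> \<open>A point \<open>w\<close> near \<open>z\<close> is compared with \<open>r * z\<close> by way of \<open>r * sgn w\<close>: first along its own radius,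
        where the modulus \<open>G\<close> applies, then on the circle of radius \<open>r\<close>, where \<open>T\<close> is continuous.\<close>
      have "((\<lambda>w. T (of_real r * sgn w)) \<longlongrightarrow> T (of_real r * z)) (nhds z)"
        by (intro isCont_tendsto_compose[OF isContT[OF rz]] tendsto_intros lim)
      then have ev1: "\<forall>\<^sub>F w in nhds z. dist (T (of_real r * sgn w)) (T (of_real r * z)) < e / 2"
        using e by (intro tendstoD) auto
      have "((\<lambda>w. Re (z * cnj (sgn w))) \<longlongrightarrow> Re (z * cnj z)) (nhds z)"
        by (intro tendsto_intros lim)
      moreover have "Re (z * cnj z) > 1 / 2"
        using nz by (simp add: complex_norm_square[symmetric])
      ultimately have ev2: "\<forall>\<^sub>F w in nhds z. Re (z * cnj (sgn w)) > 1 / 2"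
        by (rule order_tendstoD(1))
      have "((\<lambda>w. cmod w) \<longlongrightarrow> cmod z) (nhds z)"
        by (intro tendsto_norm filterlim_ident)
      then have ev3: "\<forall>\<^sub>F w in nhds z. cmod w > r"
        using r nz by (intro order_tendstoD(1)) auto
      have "\<forall>\<^sub>F w in nhds z. w \<in> ball 0 1 \<longrightarrow> dist (T w) (T (of_real r * z)) < e"
        using ev1 ev2 ev3
      proof eventually_elim
        case (elim w)
        show ?case
        proof
          assume w: "w \<in> ball 0 1"
          have "w \<noteq> 0" using elim r by auto
          have "cmod (sgn w) = 1"
            using \<open>w \<noteq> 0\<close> by (simp add: norm_sgn)
          moreover have "of_real (cmod w) * sgn w = w"
            using \<open>w \<noteq> 0\<close> by (simp add: sgn_eq)
          ultimately have "dist (T w) (T (of_real r * sgn w)) \<le> G (cmod w) - G r"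
            using G[of "sgn w" r "cmod w"] elim r w by simp
          also have "\<dots> < e / 2"
            using r(3)[of "cmod w"] elim w by simp
          finally have "dist (T w) (T (of_real r * sgn w)) < e / 2" .
          then show "dist (T w) (T (of_real r * z)) < e"
            using elim dist_triangle[of "T w" "T (of_real r * z)" "T (of_real r * sgn w)"] by linarith
        qed
      qed
      then show ?thesis by blast
    qed
  qed auto
  then obtain \<Phi> where "\<And>z. z \<in> ball 0 1 \<Longrightarrow> \<Phi> z = Finite_Point (\<phi> z)"
    "uniformly_continuous_on (closure (ball 0 1)) \<Phi>"
    unfolding T_def using extension_to_one_point by metis
  then show ?thesis by (intro exI[of _ \<Phi>]) simp
qed

end
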